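(* With objects the labeled rooted forests together with the empty forest $\emptyset$, with morphism sets $$\operatorname{Hom}(F_1,F_2)=\{(C_1,C_2,f)\mid C_i \text{ is an admissible cut of } F_i\ (i=1,2),\ f:R_{C_1}(F_1)\xrightarrow{\ \cong\ }P_{C_2}(F_2)\},$$ with identity morphisms $(C_{null},C_{full},\mathrm{id})\in\operatorname{Hom}(F,F)$, and with the composition of morphisms defined in the context, $\mathcal{LRF}$ forms a category.
   Context: A rooted tree is a finite one-dimensional contractible simplicial complex $T$ (non-empty, non-planar) with a distinguished vertex $r(T)$, the root; $V(T)$ and $E(T)$ are its sets of vertices and edges. A labeled rooted tree is a rooted tree together with a bijection from a subset $S\subset\mathbb N$ to $V(T)$; write $\mathrm{lab}(T)=S$, identified with $V(T)$. A labeled rooted forest is a finite set $F=\{T_1,\dots,T_n\}$ of labeled rooted trees with pairwise disjoint label sets, so that $V(F)=\bigsqcup_i V(T_i)$. The empty forest $\emptyset$ is also allowed; empty trees occurring in a forest are discarded. Admissible cuts: an admissible cut of a labeled tree $T$ is a subset $C\subset E(T)$ such that at most one member of $C$ lies on any path joining a leaf to the root. Removing the edges of $C$ divides $T$ into a rooted tree $R_C(T)$, the component containing the root, and a forest $P_C(T)$ formed by the other components (each rooted at its vertex closest to $r(T)$). The empty cut is $C_{null}=\emptyset$, with $(P_{C_{null}}(T),R_{C_{null}}(T))=(\emptyset,T)$; in addition a formal "full" cut $C_{full}$ is allowed as an admissible cut, with $(P_{C_{full}}(T),R_{C_{full}}(T))=(T,\emptyset)$. An admissible cut $C$ of a forest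 $F=\{T_1,\dots,T_n\}$ is a tuple $(C_1,\dots,C_n)$ with $C_i$ an admissible cut of $T_i$, and $P_C(F)=\{P_{C_1}(T_1),\dots,P_{C_n}(T_n)\}$ (the union of these forests), $R_C(F)=\{R_{C_1}(T_1),\dots,R_{C_n}(T_n)\}$. On a forest, $C_{null}$ and $C_{full}$ denote the cuts which are null, respectively full, on every tree. A subforest of $F$ is a forest of the form $P_C(F)$ for an admissible cut $C$ of $F$. An isomorphism of labeled rooted trees $f:T_1\cong T_2$ is a root- and incidence-preserving bijection $\mathrm{lab}(T_1)\to\mathrm{lab}(T_2)$ (labels need not be preserved); an isomorphism of forests is a bijection between their vertex sets that matches up their trees bijectively and restricts to an isomorphism on each matched pair. Composition: let $(C_1,C_2,f)\in\operatorname{Hom}(F_1,F_2)$ and $(D_2,D_3,g)\in\operatorname{Hom}(F_2,F_3)$. The cut $D_2$ on $F_2$ induces an admissible cut on the subforest $P_{C_2}(F_2)$, namely the one whose cut-off part consists of the vertices in $V(P_{C_2}(F_2))\cap V(P_{D_2}(F_2))$. Via $f$ this gives an admissible cut of $R_{C_1}(F_1)$, which corresponds to a unique admissible cut $E_1$ of $F_1$ with $P_{C_1}(F_1)\subset P_{E_1}(F_1)$; explicitly $V(P_{E_1}(F_1))=V(P_{C_1}(F_1))\cup f^{-1}(V(P_{C_2}(F_2))\cap V(P_{D_2}(F_2)))$. The image $g\circ f(R_{E_1}(F_1))\subset F_3$ is a subforest $P_{E_3}(F_3)$ for a unique admissible cut $E_3$ of $F_3$. The composition is $(D_2,D_3,g)\circ(C_1,C_2,f):=(E_1,E_3,g\circ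 f)$, where $g\circ f$ is understood as restricted to $R_{E_1}(F_1)$. *)

theory Defs
  imports "HOL-Analysis.Analysis"
begin

section \<open>Categories given by a family of hom-sets\<close>

text \<open>\<open>Comp A B C g f\<close> is the composite of \<open>f \<in> Hom A B\<close> followed by \<open>g \<in> Hom B C\<close>.
  Hom-sets of different pairs of objects need not be disjoint.\<close>

locale category =
  fixes Obj :: "'o set"
    and Hom :: "'o \<Rightarrow> 'o \<Rightarrow> 'm set"
    and Id :: "'o \<Rightarrow> 'm"
    and Comp :: "'o \<Rightarrow> 'o \<Rightarrow> 'o \<Rightarrow> 'm \<Rightarrow> 'm \<Rightarrow> 'm"
  assumes Id_in_Hom: "A \<in> Obj \<Longrightarrow> Id A \<in> Hom A A"
    and Comp_in_Hom: "\<lbrakk>A \<in> Obj; B \<in> Obj; C \<in> Obj; f \<in> Hom A B; g \<in> Hom B C\<rbrakk>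
      \<Longrightarrow> Comp A B C g f \<in> Hom A C"
    and Comp_Id_right: "\<lbrakk>A \<in> Obj; B \<in> Obj; f \<in> Hom A B\<rbrakk> \<Longrightarrow> Comp A A B f (Id A) = f"
    and Comp_Id_left: "\<lbrakk>A \<in> Obj; B \<in> Obj; f \<in> Hom A B\<rbrakk> \<Longrightarrow> Comp A B B (Id B) f = f"
    and Comp_assoc: "\<lbrakk>A \<in> Obj; B \<in> Obj; C \<in> Obj; D \<in> Obj;
        f \<in> Hom A B; g \<in> Hom B C; h \<in> Hom C D\<rbrakk>
      \<Longrightarrow> Comp A C D h (Comp A B C g f) = Comp A B D (Comp B C D h g) f"


section \<open>Labeled rooted trees and forests\<close>

text \<open>Vertices are identified with their labels; an edge is the set of its two endpoints.\<close>

record labeled_tree =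
  lab :: "nat set"
  edges :: "nat set set"
  tree_root :: nat

text \<open>The geometric realization of the simplicial complex whose simplices are the vertices and
  the edges, in barycentric coordinates. The topology on \<^typ>\<open>nat \<Rightarrow> real\<close> is the product topology;
  for a finite complex it induces the usual topology.\<close>

definition simplices :: "labeled_tree \<Rightarrow> nat set set" where
  "simplices T = (\<lambda>v. {v}) ` lab T \<union> edges T"

definition realization :: "labeled_tree \<Rightarrow> (nat \<Rightarrow> real) set" where
  "realization T =
    {x. (\<forall>v. 0 \<le> x v) \<and> {v. x v \<noteq> 0} \<in> simplices T \<and> (\<Sum>v\<in>lab T. x v) = 1}"

definition labeled_rooted_tree :: "labeled_tree \<Rightarrow> bool" where
  "labeled_rooted_tree T \<longleftrightarrow>
     finite (lab T) \<and> tree_root T \<in> lab T \<and>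
     (\<forall>e\<in>edges T. e \<subseteq> lab T \<and> card e = 2) \<and>
     contractible_space (top_of_set (realization T))"

type_synonym forest = "labeled_tree set"

definition labeled_rooted_forest :: "forest \<Rightarrow> bool" where
  "labeled_rooted_forest F \<longleftrightarrow>
     finite F \<and> (\<forall>T\<in>F. labeled_rooted_tree T) \<and> disjoint_family_on lab F"

definition verts :: "forest \<Rightarrow> nat set" where
  "verts F = (\<Union>T\<in>F. lab T)"


section \<open>Admissible cuts\<close>

definition is_path :: "labeled_tree \<Rightarrow> nat \<Rightarrow> nat list \<Rightarrow> nat \<Rightarrow> bool" where
  "is_path T u p v \<longleftrightarrow>
     p \<noteq> [] \<and> hd p = u \<and> last p = v \<and> set p \<subseteq> lab T \<and> distinct p \<and>
     successively (\<lambda>x y. {x, y} \<in> edges T) p"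

definition path_edges :: "nat list \<Rightarrow> nat set set" where
  "path_edges p = {{p ! i, p ! Suc i} | i. Suc i < length p}"

text \<open>The root of a one-vertex tree is a leaf; otherwise a leaf is a vertex of degree one
  different from the root.\<close>

definition leaf :: "labeled_tree \<Rightarrow> nat \<Rightarrow> bool" where
  "leaf T v \<longleftrightarrow>
     v \<in> lab T \<and> (lab T = {tree_root T} \<or> v \<noteq> tree_root T \<and> card {e \<in> edges T. v \<in> e} = 1)"

text \<open>The full cut is a formal symbol, not a set of edges.\<close>

datatype cut = Edge_Cut "nat set set" | Full_Cut

fun admissible_tree_cut :: "labeled_tree \<Rightarrow> cut \<Rightarrow> bool" where
  "admissible_tree_cut T (Edge_Cut C) \<longleftrightarrow>
     C \<subseteq> edges T \<and>
     (\<forall>v p. leaf T v \<and> is_path T v p (tree_root T) \<longrightarrow> card (C \<inter> path_edges p) \<le> 1)"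
| "admissible_tree_cut T Full_Cut \<longleftrightarrow> True"

definition adjacency :: "nat set set \<Rightarrow> nat rel" where
  "adjacency E = {(u, v). {u, v} \<in> E}"

definition tree_dist :: "labeled_tree \<Rightarrow> nat \<Rightarrow> nat \<Rightarrow> nat" where
  "tree_dist T u v = (LEAST n. (u, v) \<in> adjacency (edges T) ^^ n)"

definition component :: "labeled_tree \<Rightarrow> nat set set \<Rightarrow> nat \<Rightarrow> nat set" where
  "component T C v = {w \<in> lab T. (v, w) \<in> (adjacency (edges T - C))\<^sup>*}"

text \<open>The component with vertex set \<open>S\<close>, rooted at its vertex closest to the root of \<open>T\<close>.\<close>

definition component_tree :: "labeled_tree \<Rightarrow> nat set set \<Rightarrow> nat set \<Rightarrow> labeled_tree" where
  "component_tree T C S =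
     \<lparr>lab = S, edges = {e \<in> edges T - C. e \<subseteq> S},
      tree_root = arg_min_on (tree_dist T (tree_root T)) S\<rparr>"

text \<open>The root part of a tree is returned as a forest with at most one tree, so that the empty
  tree left by the full cut is the empty forest.\<close>

fun R_tree :: "cut \<Rightarrow> labeled_tree \<Rightarrow> forest" where
  "R_tree (Edge_Cut C) T = {component_tree T C (component T C (tree_root T))}"
| "R_tree Full_Cut T = {}"

fun P_tree :: "cut \<Rightarrow> labeled_tree \<Rightarrow> forest" where
  "P_tree (Edge_Cut C) T =
     component_tree T C ` (component T C ` lab T - {component T C (tree_root T)})"
| "P_tree Full_Cut T = {T}"

text \<open>A cut of a forest is a family of cuts indexed by its trees, normalized to be
  \<^const>\<open>undefined\<close> off the forest.\<close>

type_synonym forest_cut = "labeled_tree \<Rightarrow> cut"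

definition admissible_cuts :: "forest \<Rightarrow> forest_cut set" where
  "admissible_cuts F = (\<Pi>\<^sub>E T\<in>F. {c. admissible_tree_cut T c})"

definition P :: "forest_cut \<Rightarrow> forest \<Rightarrow> forest" where
  "P C F = (\<Union>T\<in>F. P_tree (C T) T)"

definition R :: "forest_cut \<Rightarrow> forest \<Rightarrow> forest" where
  "R C F = (\<Union>T\<in>F. R_tree (C T) T)"

definition null_cut :: "forest \<Rightarrow> forest_cut" where
  "null_cut F = (\<lambda>T\<in>F. Edge_Cut {})"

definition full_cut :: "forest \<Rightarrow> forest_cut" where
  "full_cut F = (\<lambda>T\<in>F. Full_Cut)"


section \<open>Isomorphisms\<close>

definition tree_iso :: "(nat \<Rightarrow> nat) \<Rightarrow> labeled_tree \<Rightarrow> labeled_tree \<Rightarrow> bool" where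
  "tree_iso f T T' \<longleftrightarrow>
     bij_betw f (lab T) (lab T') \<and> f (tree_root T) = tree_root T' \<and>
     (\<forall>u\<in>lab T. \<forall>v\<in>lab T. {u, v} \<in> edges T \<longleftrightarrow> {f u, f v} \<in> edges T')"

definition forest_iso :: "(nat \<Rightarrow> nat) \<Rightarrow> forest \<Rightarrow> forest \<Rightarrow> bool" where
  "forest_iso f F F' \<longleftrightarrow>
     bij_betw f (verts F) (verts F') \<and>
     (\<exists>m. bij_betw m F F' \<and> (\<forall>T\<in>F. tree_iso f T (m T)))"


section \<open>The category of labeled rooted forests\<close>

type_synonym morphism = "forest_cut \<times> forest_cut \<times> (nat \<Rightarrow> nat)"

text \<open>The bijection of a morphism is \<^const>\<open>undefined\<close> off its domain, so that equality of
  morphisms is equality of bijections.\<close>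

definition LRF_Hom :: "forest \<Rightarrow> forest \<Rightarrow> morphism set" where
  "LRF_Hom F1 F2 =
     {(C1, C2, f). C1 \<in> admissible_cuts F1 \<and> C2 \<in> admissible_cuts F2 \<and>
        f \<in> extensional (verts (R C1 F1)) \<and> forest_iso f (R C1 F1) (P C2 F2)}"

definition LRF_Id :: "forest \<Rightarrow> morphism" where
  "LRF_Id F = (null_cut F, full_cut F, \<lambda>v\<in>verts F. v)"

text \<open>A cut is specified by the vertex set of its cut-off part. That exactly one admissible cut
  meets each specification used in \<open>LRF_Comp\<close> is what \<open>LRF_Comp_well_defined\<close> expresses.\<close>

definition cuts_off :: "forest \<Rightarrow> nat set \<Rightarrow> forest_cut \<Rightarrow> bool" where
  "cuts_off F S E \<longleftrightarrow> E \<in> admissible_cuts F \<and> verts (P E F) = S"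

definition E1_verts :: "forest \<Rightarrow> forest \<Rightarrow> morphism \<Rightarrow> morphism \<Rightarrow> nat set" where
  "E1_verts F1 F2 = (\<lambda>(D2, D3, g) (C1, C2, f).
     verts (P C1 F1) \<union>
     {v \<in> verts (R C1 F1). f v \<in> verts (P C2 F2) \<inter> verts (P D2 F2)})"

definition E1_cut :: "forest \<Rightarrow> forest \<Rightarrow> morphism \<Rightarrow> morphism \<Rightarrow> forest_cut" where
  "E1_cut F1 F2 b a = (THE E. cuts_off F1 (E1_verts F1 F2 b a) E)"

definition E3_verts :: "forest \<Rightarrow> forest \<Rightarrow> morphism \<Rightarrow> morphism \<Rightarrow> nat set" where
  "E3_verts F1 F2 = (\<lambda>(D2, D3, g) (C1, C2, f).
     (g \<circ> f) ` verts (R (E1_cut F1 F2 (D2, D3, g) (C1, C2, f)) F1))"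

definition E3_cut :: "forest \<Rightarrow> forest \<Rightarrow> forest \<Rightarrow> morphism \<Rightarrow> morphism \<Rightarrow> forest_cut" where
  "E3_cut F1 F2 F3 b a = (THE E. cuts_off F3 (E3_verts F1 F2 b a) E)"

definition LRF_Comp :: "forest \<Rightarrow> forest \<Rightarrow> forest \<Rightarrow> morphism \<Rightarrow> morphism \<Rightarrow> morphism" where
  "LRF_Comp F1 F2 F3 = (\<lambda>(D2, D3, g) (C1, C2, f).
     let E1 = E1_cut F1 F2 (D2, D3, g) (C1, C2, f);
         E3 = E3_cut F1 F2 F3 (D2, D3, g) (C1, C2, f)
     in (E1, E3, restrict (g \<circ> f) (verts (R E1 F1))))"

definition LRF_Comp_well_defined :: bool where
  "LRF_Comp_well_defined \<longleftrightarrow>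
     (\<forall>F1 F2 F3 a b.
        labeled_rooted_forest F1 \<and> labeled_rooted_forest F2 \<and> labeled_rooted_forest F3 \<and>
        a \<in> LRF_Hom F1 F2 \<and> b \<in> LRF_Hom F2 F3 \<longrightarrow>
        (\<exists>!E. cuts_off F1 (E1_verts F1 F2 b a) E) \<and>
        (\<exists>!E. cuts_off F3 (E3_verts F1 F2 b a) E))"

end

theory Submission
  imports Defs
begin

text \<open>
  Each cut of a forest is determined by the vertex set of its cut-off part, and once everything is
  expressed through vertex sets the category axioms become identities between sets and functions.

  Orient every edge of a tree away from the root. The resulting arcs form an arborescence, the
  cut-off parts of admissible cuts are exactly the sets of vertices closed under passing to
  descendants (lemmas \<open>tree_cut_bij\<close>, \<open>cut_exists\<close>, \<open>cut_unique\<close>), and the arcs of \<open>P\<close> and \<open>R\<close>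
  are the arcs of the forest between two cut-off, respectively two remaining, vertices
  (\<open>cut_parts\<close>). An isomorphism of forests is the same as a bijection of vertices preserving
  arcs in both directions (\<open>forest_iso_iff\<close>), since roots are the vertices without incoming arc
  and the vertices of a tree are the descendants of its root.

  Hence a morphism from a forest with vertex set \<open>V\<close> is a descendant-closed \<open>S \<subseteq> V\<close> together
  with an arc-preserving bijection \<open>f\<close> from \<open>V - S\<close> onto a descendant-closed set of the target
  (\<open>LRF_Hom_iff\<close>); it is determined by \<open>S\<close> and \<open>f\<close>. The composite with \<open>(Q, g)\<close> is
  \<open>(S \<union> f\<^sup>-\<^sup>1 Q, g \<circ> f)\<close>, whose first component and whose image are again closed
  (\<open>LRF_Comp_characterization\<close>), and this composition is visibly associative and unital.

  What remains is to see that the topological trees of the statement are combinatorial trees. If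
  the realization is contractible then it is connected, so the graph is connected. An edge that
  lies on a cycle would give a map from the realization to the circle that winds once around along
  this edge and is constant elsewhere. On a contractible space such a map has a continuous
  logarithm, which is impossible. So every edge is a bridge
  (\<open>labeled_rooted_tree_connected\<close>, \<open>labeled_rooted_tree_bridge\<close>), and a connected graph all of
  whose edges are bridges is an arborescence seen from any root (\<open>bridges_imp_arb_tree\<close>).
\<close>

section \<open>Contractible graphs are trees\<close>

abbreviation vertex_pt :: "nat \<Rightarrow> nat \<Rightarrow> real" where
  "vertex_pt u \<equiv> \<lambda>w. of_bool (w = u)"

text \<open>The affine parametrization of an edge, in barycentric coordinates.\<close>

definition edge_pt :: "nat \<Rightarrow> nat \<Rightarrow> real \<Rightarrow> nat \<Rightarrow> real" where
  "edge_pt u v t = (\<lambda>w. t * of_bool (w = u) + (1 - t) * of_bool (w = v))"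

text \<open>The logarithm theorem for contractible sets concerns subsets of normed spaces, and the function
  space carrying the realization is not normed. Functions with support in a finite set embed
  homeomorphically into the normed space of bounded continuous functions on the discrete space of
  naturals, by sending each vertex to its indicator function.\<close>

lemma contractible_finite_support_logarithm:
  fixes X :: "(nat \<Rightarrow> real) set" and \<phi> :: "(nat \<Rightarrow> real) \<Rightarrow> complex"
  assumes "contractible X" and "finite V" and supp: "\<And>x. x \<in> X \<Longrightarrow> {v. x v \<noteq> 0} \<subseteq> V"
    and \<phi>: "continuous_on X \<phi>" "\<And>x. x \<in> X \<Longrightarrow> \<phi> x \<noteq> 0"
  obtains g where "continuous_on X g" "\<And>x. x \<in> X \<Longrightarrow> \<phi> x = exp (g x)"
proof -
  have bc: "(\<lambda>w. of_bool (w = v) :: real) \<in> bcontfun" for v :: nat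
    unfolding bcontfun_def by (auto simp: bounded_iff intro!: exI[of _ 1])
  define e :: "nat \<Rightarrow> (nat \<Rightarrow>\<^sub>C real)" where "e v = Bcontfun (\<lambda>w. of_bool (w = v))" for v
  have e: "apply_bcontfun (e v) w = of_bool (w = v)" for v w
    by (simp add: e_def Bcontfun_inverse[OF bc])
  define J where "J x = (\<Sum>v\<in>V. x v *\<^sub>R e v)" for x :: "nat \<Rightarrow> real"
  have sum_app: "apply_bcontfun (\<Sum>v\<in>W. x v *\<^sub>R e v) w = (\<Sum>v\<in>W. x v * of_bool (w = v))"
    if "finite W" for W w x
    using that by (induction W) (auto simp: e zero_bcontfun.rep_eq plus_bcontfun.rep_eq scaleR_bcontfun.rep_eq)
  have inv: "apply_bcontfun (J x) = x" if "x \<in> X" for x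
    using supp[OF that] \<open>finite V\<close> 
    by (auto simp: J_def sum_app fun_eq_iff of_bool_def if_distrib sum.delta cong: if_cong)
  have cJ: "continuous_on X J"
    unfolding J_def 
    by (intro continuous_intros continuous_on_subset[OF continuous_on_product_coordinates]) simp
  have cI: "continuous_on A (apply_bcontfun :: (nat \<Rightarrow>\<^sub>C real) \<Rightarrow> nat \<Rightarrow> real)" for A
  proof (rule continuous_on_coordinatewise_then_product)
    fix w show "continuous_on A (\<lambda>f. apply_bcontfun f w :: real)"
      unfolding continuous_on_iff
      by (meson dist_fun_lt_imp_dist_val_lt)
  qed
  have "homeomorphic_maps (top_of_set X) (top_of_set (J ` X)) J apply_bcontfun"
    using cJ cI by (auto simp: homeomorphic_maps_def inv)
  then have contr: "contractible (J ` X)"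
    using assms(1) homeomorphic_space_contractibility[of "top_of_set X" "top_of_set (J ` X)"]
    by (auto simp: homeomorphic_space_def)
  have cont: "continuous_on (J ` X) (\<phi> \<circ> apply_bcontfun)"
    by (rule continuous_on_compose[OF cI]) (simp add: image_image inv \<phi>)
  have nz: "(\<phi> \<circ> apply_bcontfun) z \<noteq> 0" if "z \<in> J ` X" for z
    using that \<phi>(2) inv by auto
  obtain g where g: "continuous_on (J ` X) g"
      "\<And>y. y \<in> J ` X \<Longrightarrow> (\<phi> \<circ> apply_bcontfun) y = exp (g y)"
    using continuous_logarithm_on_contractible[OF cont contr nz] by blast
  show thesis
  proof (rule that[of "g \<circ> J"])
    show "continuous_on X (g \<circ> J)" using continuous_on_compose[OF cJ g(1)] .
    show "\<phi> x = exp ((g \<circ> J) x)" if "x \<in> X" for x using g(2)[of "J x"] that inv by simp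
  qed
qed

text \<open>The values of \<open>h\<close> lie in the discrete set of integer multiples of \<open>2 \<pi> \<i>\<close>, so \<open>h\<close> is constant.\<close>

lemma logarithm_of_one_constant:
  fixes h :: "real \<Rightarrow> complex"
  assumes "continuous_on {0..1} h" "\<And>t. t \<in> {0..1} \<Longrightarrow> exp (h t) = 1"
  shows "h 0 = h 1"
proof -
  have *: "\<exists>e>0. \<forall>y. y \<in> {0..1} \<and> h y \<noteq> h x \<longrightarrow> e \<le> norm (h y - h x)" if "x \<in> {0..1}" for x
  proof (intro exI[of _ "2 * pi"] conjI allI impI)
    fix y assume y: "y \<in> {0..1} \<and> h y \<noteq> h x"
    then have "exp (h y) = exp (h x)" using assms(2) that by simp
    then obtain n :: int where n: "h y = h x + (of_int (2 * n) * pi) * \<i>" by (auto simp: exp_eq)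
    with y have "n \<noteq> 0" by auto
    then have "1 \<le> \<bar>real_of_int n\<bar>" by linarith
    then show "2 * pi \<le> norm (h y - h x)" using n by (simp add: norm_mult)
  qed simp
  have "h constant_on {0..1}"
    by (rule continuous_discrete_range_constant[OF _ assms(1)]) (use * in auto)
  then show ?thesis unfolding constant_on_def by force
qed

lemma edge_pt_in_realization:
  assumes T: "labeled_rooted_tree T" and e: "{u, v} \<in> edges T" and t: "0 \<le> t" "t \<le> 1"
  shows "edge_pt u v t \<in> realization T"
proof -
  have uv: "u \<in> lab T" "v \<in> lab T" "u \<noteq> v" and fin: "finite (lab T)"
    using T e by (auto simp: labeled_rooted_tree_def card_2_iff)
  have "(\<Sum>w\<in>lab T. edge_pt u v t w) = 1"
    using uv fin by (simp add: edge_pt_def sum.distrib sum_distrib_left[symmetric] of_bool_def)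
  moreover have "{w. edge_pt u v t w \<noteq> 0} \<in> simplices T"
  proof -
    have "{w. edge_pt u v t w \<noteq> 0} = (if t = 0 then {v} else if t = 1 then {u} else {u, v})"
      using uv by (auto simp: edge_pt_def)
    then show ?thesis using uv e by (auto simp: simplices_def)
  qed
  ultimately show ?thesis using t by (auto simp: realization_def edge_pt_def)
qed

lemma continuous_on_edge_pt: "continuous_on A (edge_pt u v)"
  unfolding edge_pt_def by (intro continuous_on_coordinatewise_then_product continuous_intros)

lemma edge_pt_endpoints: "edge_pt u v 1 = vertex_pt u" "edge_pt u v 0 = vertex_pt v"
  by (auto simp: edge_pt_def)

lemma support_realization:
  assumes T: "labeled_rooted_tree T" and x: "x \<in> realization T"
  shows "{v. x v \<noteq> 0} \<subseteq> lab T"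
proof -
  have "s \<subseteq> lab T" if "s \<in> simplices T" for s
    using that T by (auto simp: simplices_def labeled_rooted_tree_def)
  then show ?thesis using x by (auto simp: realization_def)
qed

lemma continuous_on_sum_coordinates: "continuous_on A (\<lambda>x. \<Sum>v\<in>K. x v)" for A :: "(nat \<Rightarrow> real) set"
  by (intro continuous_on_sum continuous_on_subset[OF continuous_on_product_coordinates]) simp

text \<open>The sum of the barycentric coordinates over the component of the root takes only the values 0
  and 1 on the realization, because no simplex meets two components. It would take both values if
  some vertex were not reachable.\<close>

lemma labeled_rooted_tree_connected:
  assumes T: "labeled_rooted_tree T" and u: "u \<in> lab T"
  shows "(tree_root T, u) \<in> (adjacency (edges T))\<^sup>*"
proof (rule ccontr)
  assume nu: "(tree_root T, u) \<notin> (adjacency (edges T))\<^sup>*"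
  define K where "K = {v \<in> lab T. (tree_root T, v) \<in> (adjacency (edges T))\<^sup>*}"
  define h where "h x = (\<Sum>v\<in>K. x v)" for x :: "nat \<Rightarrow> real"
  have fin: "finite (lab T)" "finite K" and r: "tree_root T \<in> K"
    using T by (auto simp: labeled_rooted_tree_def K_def)
  have h01: "h x \<in> {0, 1}" if x: "x \<in> realization T" for x
  proof -
    define s where "s = {v. x v \<noteq> 0}"
    have s: "s \<in> simplices T" and sum: "(\<Sum>v\<in>lab T. x v) = 1" using x by (auto simp: realization_def s_def)
    have "s \<subseteq> K \<or> s \<inter> K = {}"
    proof (cases "\<exists>v. s = {v}")
      case False
      then have "s \<in> edges T" using s by (auto simp: simplices_def)
      then obtain a b where ab: "s = {a, b}" "a \<in> lab T" "b \<in> lab T" "{a,b} \<in> edges T"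
        using T by (auto simp: labeled_rooted_tree_def card_2_iff)
      then have "(a, b) \<in> adjacency (edges T)" "(b, a) \<in> adjacency (edges T)"
        by (auto simp: adjacency_def insert_commute)
      then have "a \<in> K \<longleftrightarrow> b \<in> K" using ab by (auto simp: K_def intro: rtrancl_into_rtrancl)
      then show ?thesis using ab by auto
    qed auto
    then show ?thesis
    proof
      assume "s \<subseteq> K"
      then have "h x = (\<Sum>v\<in>lab T. x v)"
        unfolding h_def by (intro sum.mono_neutral_left) (auto simp: s_def K_def fin)
      then show ?thesis using sum by simp
    next
      assume "s \<inter> K = {}"
      then have "h x = 0" unfolding h_def s_def by (intro sum.neutral) auto
      then show ?thesis by simp
    qed
  qed
  have vp: "vertex_pt w \<in> realization T" if "w \<in> lab T" for w
    using that fin by (auto simp: realization_def simplices_def of_bool_def)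
  have "connected (realization T)"
    using T contractible_imp_connected_space[of "top_of_set (realization T)"]
    by (simp add: labeled_rooted_tree_def connectedin_def flip: connectedin_iff_connected)
  then have conn: "connected (h ` realization T)"
    by (intro connected_continuous_image) (auto simp: h_def continuous_on_sum_coordinates)
  have "h (vertex_pt (tree_root T)) = 1" "h (vertex_pt u) = 0"
    using r nu fin by (auto simp: h_def of_bool_def K_def)
  then have "0 \<in> h ` realization T" "1 \<in> h ` realization T"
    using vp[OF u] vp[of "tree_root T"] r by (force simp: K_def)+
  then have "1/2 \<in> h ` realization T"
    using connectedD_interval[OF conn, of 0 1 "1/2"] by auto
  then show False using h01 by force
qed

text \<open>Wrap the edge \<open>{a, b}\<close> once around the circle and send the rest of the realization to 1. A
  logarithm \<open>g\<close> of this map is constant along every other edge, so \<open>g\<close> agrees at \<open>a\<close> and \<open>b\<close> if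
  these are connected by other edges; but along \<open>{a, b}\<close> it increases by \<open>2 \<pi> \<i>\<close>.\<close>

lemma labeled_rooted_tree_bridge:
  assumes T: "labeled_rooted_tree T" and e: "{a, b} \<in> edges T"
  shows "(a, b) \<notin> (adjacency (edges T - {{a, b}}))\<^sup>*"
proof
  assume path: "(a, b) \<in> (adjacency (edges T - {{a, b}}))\<^sup>*"
  have ab: "a \<noteq> b" and contr: "contractible (realization T)" and fin: "finite (lab T)"
    using T e by (auto simp: labeled_rooted_tree_def card_2_iff)
  let ?X = "realization T"
  define \<phi> :: "(nat \<Rightarrow> real) \<Rightarrow> complex" where
    "\<phi> x = (if x a + x b = 1 then exp (2 * pi * \<i> * x a) else 1)" for x
  have co: "continuous_on A (\<lambda>x. x w)" for A :: "(nat \<Rightarrow> real) set" and w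
    by (rule continuous_on_subset[OF continuous_on_product_coordinates]) simp
  \<comment> \<open>The realization is the union of the closed segment from \<open>a\<close> to \<open>b\<close> and the closed set
    outside its interior; on their intersection both formulas for \<open>\<phi>\<close> give 1.\<close>
  have cover: "x a + x b = 1 \<or> x a * x b = 0" if "x \<in> ?X" for x
  proof (rule disjCI)
    assume "x a * x b \<noteq> 0"
    then have "{a, b} \<subseteq> {v. x v \<noteq> 0}" by auto
    moreover have s: "{v. x v \<noteq> 0} \<in> simplices T" and sum: "(\<Sum>v\<in>lab T. x v) = 1"
      using that by (auto simp: realization_def)
    moreover have "{v. x v \<noteq> 0} \<in> edges T"
    proof -
      have "{v. x v \<noteq> 0} \<notin> (\<lambda>v. {v}) ` lab T" using calculation(1) ab by fastforce
      then show ?thesis using s unfolding simplices_def by blast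
    qed
    then have "card {v. x v \<noteq> 0} = 2" "{v. x v \<noteq> 0} \<subseteq> lab T"
      using T by (auto simp: labeled_rooted_tree_def)
    ultimately have eq: "{v. x v \<noteq> 0} = {a, b}"
      using ab by (metis card_2_iff card_subset_eq finite_subset fin)
    have "(\<Sum>v\<in>lab T. x v) = (\<Sum>v\<in>{a,b}. x v)"
      using eq \<open>_ \<subseteq> lab T\<close> by (intro sum.mono_neutral_right fin) auto
    then show "x a + x b = 1" using sum ab by simp
  qed
  have one: "\<phi> x = 1" if "x a * x b = 0" for x
    using that by (auto simp: \<phi>_def)
  have \<phi>c: "continuous_on ?X \<phi>"
  proof -
    let ?S = "{x \<in> ?X. x a + x b = 1}" and ?T = "{x \<in> ?X. x a * x b = 0}"
    have "continuous_on (?S \<union> ?T) (\<lambda>x. if x a + x b = 1 then exp (2 * pi * \<i> * x a) else 1 :: complex)"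
    proof (rule continuous_on_cases_local)
      have "closedin (top_of_set ?X) ?S" "closedin (top_of_set ?X) ?T"
        by (intro continuous_closedin_preimage_constant continuous_intros co)+
      moreover have "?S \<union> ?T = ?X" using cover by auto
      ultimately show "closedin (top_of_set (?S \<union> ?T)) ?S" "closedin (top_of_set (?S \<union> ?T)) ?T"
        by auto
    qed (use one in \<open>auto intro!: continuous_intros co simp: \<phi>_def split: if_splits\<close>)
    moreover have "?S \<union> ?T = ?X" using cover by auto
    ultimately show ?thesis unfolding \<phi>_def by simp
  qed
  have "\<phi> x \<noteq> 0" for x by (simp add: \<phi>_def)
  then obtain g where g: "continuous_on ?X g" "\<And>x. x \<in> ?X \<Longrightarrow> \<phi> x = exp (g x)"
    using contractible_finite_support_logarithm[OF contr fin support_realization[OF T] \<phi>c] by metis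
  have gc: "continuous_on {0..1} (\<lambda>t. g (edge_pt u v t))" if "{u, v} \<in> edges T" for u v
    by (rule continuous_on_compose2[OF g(1) continuous_on_edge_pt])
       (use edge_pt_in_realization[OF T that] in auto)
  have step: "g (vertex_pt u) = g (vertex_pt v)" if uv: "(u, v) \<in> adjacency (edges T - {{a, b}})" for u v
  proof -
    have E: "{u, v} \<in> edges T" "{u, v} \<noteq> {a, b}" using uv by (auto simp: adjacency_def)
    then have "u \<noteq> v" using T by (auto simp: labeled_rooted_tree_def card_2_iff)
    have "exp (g (edge_pt u v t)) = 1" if "t \<in> {0..1}" for t
    proof -
      have "edge_pt u v t a * edge_pt u v t b = 0"
        using E(2) ab by (auto simp: edge_pt_def)
      then show ?thesis using g(2) edge_pt_in_realization[OF T E(1)] that one by (metis atLeastAtMost_iff)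
    qed
    from logarithm_of_one_constant[OF gc[OF E(1)] this] show ?thesis by (simp add: edge_pt_endpoints)
  qed
  have const: "g (vertex_pt a) = g (vertex_pt b)"
    using path by (induction rule: rtrancl_induct) (auto dest: step)
  \<comment> \<open>Along the edge, \<open>g\<close> differs from the obvious logarithm by a constant.\<close>
  let ?h = "\<lambda>t. g (edge_pt a b t) - 2 * pi * \<i> * t"
  have "exp (?h t) = 1" if "t \<in> {0..1}" for t
  proof -
    have "edge_pt a b t a = t" "edge_pt a b t b = 1 - t" using ab by (auto simp: edge_pt_def)
    then have "\<phi> (edge_pt a b t) = exp (2 * pi * \<i> * t)" by (simp add: \<phi>_def)
    then show ?thesis using g(2) edge_pt_in_realization[OF T e] that by (simp add: exp_diff)
  qed
  then have "?h 0 = ?h 1"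
    by (intro logarithm_of_one_constant[of ?h] continuous_intros gc[OF e]) auto
  then show False using const by (simp add: edge_pt_endpoints)
qed

section \<open>Arborescences\<close>

text \<open>Arcs point from parent to child.\<close>

definition arborescence :: "'a rel \<Rightarrow> 'a set \<Rightarrow> 'a \<Rightarrow> bool" where
  "arborescence A V r \<longleftrightarrow>
     finite V \<and> A \<subseteq> V \<times> V \<and> r \<in> V \<and> (\<forall>u. (u, r) \<notin> A) \<and>
     (\<forall>u u' v. (u, v) \<in> A \<longrightarrow> (u', v) \<in> A \<longrightarrow> u = u') \<and> (\<forall>v\<in>V. (r, v) \<in> A\<^sup>*)"

definition undirected :: "'a rel \<Rightarrow> 'a set set" where
  "undirected A = {{u, v} | u v. (u, v) \<in> A}"

lemma doubleton_in_undirected: "{u, v} \<in> undirected A \<longleftrightarrow> (u, v) \<in> A \<or> (v, u) \<in> A"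
  unfolding undirected_def mem_Collect_eq doubleton_eq_iff by blast

lemma adjacency_undirected: "adjacency (undirected A) = A \<union> A\<inverse>"
  by (auto simp: adjacency_def doubleton_in_undirected)

lemma arborescenceD:
  assumes "arborescence A V r"
  shows "finite V" "A \<subseteq> V \<times> V" "r \<in> V" "(u, r) \<notin> A"
    and "(u, v) \<in> A \<Longrightarrow> (u', v) \<in> A \<Longrightarrow> u = u'" and "v \<in> V \<Longrightarrow> (r, v) \<in> A\<^sup>*"
  using assms unfolding arborescence_def by blast+

text \<open>Backwards from \<open>v\<close> there is only one walk, and it cannot continue beyond \<open>r\<close>.\<close>

lemma arborescence_depth_unique:
  assumes "arborescence A V r" "(r, v) \<in> A ^^ m" "(r, v) \<in> A ^^ n"
  shows "m = n"
  using assms(2,3)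
proof (induction m arbitrary: v n)
  case 0
  then show ?case using arborescenceD(4)[OF assms(1)] by (cases n) auto
next
  case (Suc m)
  then obtain w where w: "(r, w) \<in> A ^^ m" "(w, v) \<in> A" by auto
  then obtain k where "n = Suc k" using Suc.prems arborescenceD(4)[OF assms(1)] by (cases n) auto
  then obtain w' where w': "(r, w') \<in> A ^^ k" "(w', v) \<in> A" using Suc.prems by auto
  then have "w' = w" using arborescenceD(5)[OF assms(1)] w by blast
  then show ?case using Suc.IH[OF w(1)] w' \<open>n = Suc k\<close> by simp
qed

lemma arborescence_depth:
  assumes "arborescence A V r" "v \<in> V"
  obtains n where "(r, v) \<in> A ^^ n"
  using arborescenceD(6)[OF assms] by (auto dest: rtrancl_imp_relpow)

lemma arborescence_acyclic:
  assumes A: "arborescence A V r"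
  shows "acyclic A"
proof (rule acyclicI, intro allI notI)
  fix v assume v: "(v, v) \<in> A\<^sup>+"
  then obtain k where k: "k > 0" "(v, v) \<in> A ^^ k" by (auto simp: trancl_power)
  have "v \<in> V" using v arborescenceD(2)[OF A] by (auto elim: tranclE)
  then obtain n where n: "(r, v) \<in> A ^^ n" using arborescence_depth[OF A] by blast
  then have "(r, v) \<in> A ^^ (n + k)" using k by (auto simp: relpow_add)
  then show False using arborescence_depth_unique[OF A n] k by fastforce
qed

lemma arborescence_parent:
  assumes "arborescence A V r" "v \<in> V" "v \<noteq> r"
  obtains u where "(u, v) \<in> A"
  using arborescenceD(6)[OF assms(1,2)] assms(3) by (auto elim: rtranclE)

lemma arborescence_antisym:
  assumes A: "arborescence A V r" and "(u, v) \<in> A\<^sup>*" "(v, u) \<in> A"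
  shows False
  using arborescence_acyclic[OF A] assms(2,3) unfolding acyclic_def
  by (meson rtrancl_into_trancl2)

text \<open>Pairs of parent and child. Distances from the root make this explicit in terms of the tree; the
  lemma \<open>arb_treeI\<close> below recognizes it in any given orientation.\<close>

definition arcs :: "labeled_tree \<Rightarrow> nat rel" where
  "arcs T = {(u, v). {u, v} \<in> edges T \<and>
     tree_dist T (tree_root T) v = Suc (tree_dist T (tree_root T) u)}"

text \<open>The combinatorial form of a rooted tree, in which the passage to the components left by a cut is a
  matter of restricting the arcs.\<close>

definition arb_tree :: "labeled_tree \<Rightarrow> bool" where
  "arb_tree T \<longleftrightarrow> arborescence (arcs T) (lab T) (tree_root T) \<and> edges T = undirected (arcs T)"

lemma relpow_mono:
  fixes A B :: "'a rel"
  assumes "A \<subseteq> B" shows "A ^^ n \<subseteq> B ^^ n"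
  using assms by (induction n) (auto simp: relcomp_unfold)

text \<open>A step along an edge changes the depth by one, so a walk from the root to a vertex of depth \<open>n\<close>
  has at least \<open>n\<close> steps, and the directed walk attains this bound.\<close>

lemma tree_dist_depth:
  assumes A: "arborescence A (lab T) (tree_root T)" and e: "edges T = undirected A"
    and v: "(tree_root T, v) \<in> A ^^ n"
  shows "tree_dist T (tree_root T) v = n"
  unfolding tree_dist_def
proof (rule Least_equality)
  have "A ^^ n \<subseteq> (A \<union> A\<inverse>) ^^ n" by (rule relpow_mono) auto
  then show "(tree_root T, v) \<in> adjacency (edges T) ^^ n" using v by (auto simp: e adjacency_undirected)
  fix m assume "(tree_root T, v) \<in> adjacency (edges T) ^^ m"
  then show "n \<le> m" using v
  proof (induction m arbitrary: v n)
    case 0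
    then show ?case using arborescence_depth_unique[OF A, of "tree_root T" 0 n] by auto
  next
    case (Suc m)
    then obtain w where w: "(tree_root T, w) \<in> adjacency (edges T) ^^ m" "(w, v) \<in> A \<union> A\<inverse>"
      by (auto simp: e adjacency_undirected)
    then have "w \<in> lab T" using arborescenceD(2)[OF A] by auto
    then obtain k where k: "(tree_root T, w) \<in> A ^^ k" using arborescence_depth[OF A] by blast
    then have "k \<le> m" using Suc.IH w by blast
    moreover have "n \<le> Suc k"
    proof (cases "(w, v) \<in> A")
      case True
      then have "(tree_root T, v) \<in> A ^^ Suc k" using k by auto
      then show ?thesis using arborescence_depth_unique[OF A] Suc.prems(2) by (metis order_refl)
    next
      case False
      then have "(tree_root T, w) \<in> A ^^ Suc n" using Suc.prems(2) w by auto
      then have "k = Suc n" by (rule arborescence_depth_unique[OF A k])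
      then show ?thesis by simp
    qed
    ultimately show ?case by simp
  qed
qed

text \<open>An orientation of the edges as an arborescence from the root is unique, since depth is the
  distance from the root. This identifies \<^const>\<open>arcs\<close> in all later constructions.\<close>

lemma arb_treeI:
  assumes A: "arborescence A (lab T) (tree_root T)" and e: "edges T = undirected A"
  shows "arb_tree T" "arcs T = A"
proof -
  have up: "tree_dist T (tree_root T) v = Suc (tree_dist T (tree_root T) u)" if "(u, v) \<in> A" for u v
  proof -
    have "u \<in> lab T" using that arborescenceD(2)[OF A] by auto
    then obtain n where n: "(tree_root T, u) \<in> A ^^ n" using arborescence_depth[OF A] by blast
    then have "(tree_root T, v) \<in> A ^^ Suc n" using that by auto
    then show ?thesis using tree_dist_depth[OF A e] n by simp
  qed
  have "(u, v) \<in> arcs T \<longleftrightarrow> (u, v) \<in> A" for u v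
  proof
    assume "(u, v) \<in> arcs T"
    then have "(u, v) \<in> A \<or> (v, u) \<in> A" "(v, u) \<notin> A"
      using up[of v u] unfolding arcs_def e by (auto simp: doubleton_in_undirected)
    then show "(u, v) \<in> A" by blast
  qed (use up in \<open>auto simp: arcs_def e doubleton_in_undirected\<close>)
  then show *: "arcs T = A" by auto
  show "arb_tree T" using A e by (simp add: arb_tree_def *)
qed

lemma arb_treeD: 
  assumes "arb_tree T"
  shows "arborescence (arcs T) (lab T) (tree_root T)" "edges T = undirected (arcs T)"
  using assms by (auto simp: arb_tree_def)

text \<open>Choose for every vertex other than the root a neighbour closer to the root. These parent edges
  already connect the graph, so an edge not among them would not be a bridge.\<close>

lemma bridges_imp_arb_tree:
  assumes fin: "finite (lab T)" and r: "tree_root T \<in> lab T"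
    and E: "\<And>e. e \<in> edges T \<Longrightarrow> e \<subseteq> lab T \<and> card e = 2"
    and conn: "\<And>v. v \<in> lab T \<Longrightarrow> (tree_root T, v) \<in> (adjacency (edges T))\<^sup>*"
    and bridge: "\<And>a b. {a, b} \<in> edges T \<Longrightarrow> (a, b) \<notin> (adjacency (edges T - {{a, b}}))\<^sup>*"
  shows "arb_tree T"
proof -
  let ?r = "tree_root T" and ?G = "adjacency (edges T)"
  define d where "d v = tree_dist T ?r v" for v
  have dI: "(?r, v) \<in> ?G ^^ d v" if "v \<in> lab T" for v
    unfolding d_def tree_dist_def using rtrancl_imp_relpow[OF conn[OF that]] by (auto intro: LeastI)
  have dle: "d v \<le> n" if "(?r, v) \<in> ?G ^^ n" for v n
    unfolding d_def tree_dist_def using that by (rule Least_le)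
  have "\<exists>u. {u, v} \<in> edges T \<and> d u < d v" if "v \<in> lab T - {?r}" for v
  proof -
    have v: "(?r, v) \<in> ?G ^^ d v" "v \<noteq> ?r" using dI that by auto
    then obtain n where n: "d v = Suc n" by (cases "d v") auto
    then obtain u where "(?r, u) \<in> ?G ^^ n" "(u, v) \<in> ?G" using v by auto
    then show ?thesis using dle n by (auto simp: adjacency_def less_Suc_eq_le)
  qed
  then obtain par where par: "\<And>v. v \<in> lab T - {?r} \<Longrightarrow> {par v, v} \<in> edges T \<and> d (par v) < d v"
    by metis
  define A where "A = {(par v, v) | v. v \<in> lab T - {?r}}"
  have reach: "(?r, v) \<in> A\<^sup>*" if "v \<in> lab T" for v
    using that
  proof (induction "d v" arbitrary: v rule: less_induct)
    case less
    show ?case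
    proof (cases "v = ?r")
      case False
      then have v: "v \<in> lab T - {?r}" using less.prems by auto
      then have "par v \<in> lab T" using par E by blast
      then have "(?r, par v) \<in> A\<^sup>*" using less.hyps par v by blast
      moreover have "(par v, v) \<in> A" using v by (auto simp: A_def)
      ultimately show ?thesis by (rule rtrancl_into_rtrancl)
    qed auto
  qed
  have A: "arborescence A (lab T) ?r"
    unfolding arborescence_def
  proof (intro conjI)
    have "par v \<in> lab T" if "v \<in> lab T - {?r}" for v using par[OF that] E by blast
    then show "A \<subseteq> lab T \<times> lab T" by (auto simp: A_def)
  qed (use fin r reach in \<open>auto simp: A_def\<close>)
  have "edges T \<subseteq> undirected A"
  proof (rule ccontr)
    assume "\<not> edges T \<subseteq> undirected A"
    then obtain e where e: "e \<in> edges T" "e \<notin> undirected A" by auto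
    then obtain a b where ab: "e = {a, b}" "a \<in> lab T" "b \<in> lab T"
      using E[of e] by (auto simp: card_2_iff)
    have "undirected A \<subseteq> edges T - {e}" using par e by (auto simp: undirected_def A_def)
    then have "A \<union> A\<inverse> \<subseteq> adjacency (edges T - {e})"
      unfolding adjacency_undirected[symmetric] by (auto simp: adjacency_def)
    then have sub: "(A \<union> A\<inverse>)\<^sup>* \<subseteq> (adjacency (edges T - {e}))\<^sup>*" by (rule rtrancl_mono)
    have "(a, ?r) \<in> (A\<inverse>)\<^sup>*" "(?r, b) \<in> A\<^sup>*" using reach ab by (auto simp: rtrancl_converse)
    then have "(a, ?r) \<in> (A \<union> A\<inverse>)\<^sup>*" "(?r, b) \<in> (A \<union> A\<inverse>)\<^sup>*"
      by (auto intro: in_rtrancl_UnI)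
    then have "(a, b) \<in> (A \<union> A\<inverse>)\<^sup>*" by (rule rtrancl_trans)
    then show False using sub bridge[of a b] e ab by auto
  qed
  moreover have "undirected A \<subseteq> edges T" using par by (auto simp: undirected_def A_def)
  ultimately show ?thesis using arb_treeI(1)[OF A] by auto
qed

lemma labeled_rooted_tree_arb_tree:
  assumes "labeled_rooted_tree T" shows "arb_tree T"
proof (rule bridges_imp_arb_tree)
  show "finite (lab T)" "tree_root T \<in> lab T"
    and "\<And>e. e \<in> edges T \<Longrightarrow> e \<subseteq> lab T \<and> card e = 2"
    using assms by (simp_all add: labeled_rooted_tree_def)
qed (fact labeled_rooted_tree_connected[OF assms] labeled_rooted_tree_bridge[OF assms])+

section \<open>Components of a cut tree\<close>

definition uncut :: "labeled_tree \<Rightarrow> nat set set \<Rightarrow> nat rel" where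
  "uncut T C = {(u, v) \<in> arcs T. {u, v} \<notin> C}"

lemma uncut_subset: "uncut T C \<subseteq> arcs T" by (auto simp: uncut_def)

lemma adjacency_uncut:
  assumes "arb_tree T"
  shows "adjacency (edges T - C) = uncut T C \<union> (uncut T C)\<inverse>"
proof -
  have "{v, u} = {u, v}" for u v :: nat by blast
  then show ?thesis by (auto simp: adjacency_def arb_treeD(2)[OF assms] doubleton_in_undirected uncut_def)
qed

lemma reach_in_lab:
  assumes T: "arb_tree T" and "t \<in> lab T" "(t, v) \<in> (uncut T C)\<^sup>*"
  shows "v \<in> lab T"
  using assms(3,2) by (induction rule: rtrancl_induct)
    (use arborescenceD(2)[OF arb_treeD(1)[OF T]] in \<open>auto simp: uncut_def\<close>)

text \<open>The component of a vertex \<open>t\<close> without a remaining parent consists of the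
  remaining descendants of \<open>t\<close>: an undirected step upwards leads to the unique parent, which is
  where a directed walk from \<open>t\<close> came from.\<close>

lemma component_of_top:
  assumes T: "arb_tree T" and t: "t \<in> lab T" "\<And>u. (u, t) \<notin> uncut T C" and v: "(t, v) \<in> (uncut T C)\<^sup>*"
  shows "component T C v = (uncut T C)\<^sup>* `` {t}"
proof -
  let ?B = "uncut T C"
  have "(t, w) \<in> ?B\<^sup>*" if "(v, w) \<in> (?B \<union> ?B\<inverse>)\<^sup>*" for w
    using that
  proof (induction rule: rtrancl_induct)
    case base then show ?case by (rule v)
  next
    case (step x w)
    show ?case
    proof (cases "(x, w) \<in> ?B")
      case True then show ?thesis using step.IH by (rule rtrancl_into_rtrancl[rotated])
    next
      case False
      then have wx: "(w, x) \<in> ?B" using step.hyps by auto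
      from step.IH show ?thesis
      proof (cases rule: rtranclE)
        case base then show ?thesis using wx t by auto
      next
        case (step y)
        then have "y = w"
          using wx arborescenceD(5)[OF arb_treeD(1)[OF T]] uncut_subset by blast
        then show ?thesis using step by simp
      qed
    qed
  qed
  moreover have "(v, w) \<in> (?B \<union> ?B\<inverse>)\<^sup>*" if "(t, w) \<in> ?B\<^sup>*" for w
  proof -
    have "(v, t) \<in> (?B\<inverse>)\<^sup>*" using v by (simp add: rtrancl_converse)
    then show ?thesis using that by (meson in_rtrancl_UnI rtrancl_trans)
  qed
  ultimately show ?thesis
    using reach_in_lab[OF T t(1)] by (auto simp: component_def adjacency_uncut[OF T])
qed

text \<open>Climb from \<open>v\<close> towards the root until the first cut edge.\<close>

lemma top_of_component:
  assumes T: "arb_tree T" and v: "v \<in> lab T"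
  obtains t where "t \<in> lab T" "\<And>u. (u, t) \<notin> uncut T C" "(t, v) \<in> (uncut T C)\<^sup>*"
proof -
  note A = arb_treeD(1)[OF T]
  have "\<exists>t. t \<in> lab T \<and> (\<forall>u. (u, t) \<notin> uncut T C) \<and> (t, v) \<in> (uncut T C)\<^sup>*"
    using arborescenceD(6)[OF A v]
  proof (induction rule: rtrancl_induct)
    case base
    then show ?case using arborescenceD(3,4)[OF A] uncut_subset by blast
  next
    case (step w v)
    show ?case
    proof (cases "(w, v) \<in> uncut T C")
      case True
      then show ?thesis using step.IH by (meson rtrancl_into_rtrancl)
    next
      case False
      then have "(u, v) \<notin> uncut T C" for u
        using arborescenceD(5)[OF A step.hyps(2)] uncut_subset by blast
      then show ?thesis using step.hyps arborescenceD(2)[OF A] by blast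
    qed
  qed
  then show thesis using that by blast
qed

text \<open>The vertex \<open>t\<close> is the unique vertex of the component at minimal distance from the root, since
  all others are proper descendants of \<open>t\<close>. So it is the one chosen by \<^const>\<open>component_tree\<close>.\<close>

lemma component_tree_arb_tree:
  assumes T: "arb_tree T" and t: "t \<in> lab T" "\<And>u. (u, t) \<notin> uncut T C"
    and K: "K = (uncut T C)\<^sup>* `` {t}"
  shows "arb_tree (component_tree T C K)" "arcs (component_tree T C K) = uncut T C \<inter> K \<times> K"
    "lab (component_tree T C K) = K" "tree_root (component_tree T C K) = t"
proof -
  let ?B = "uncut T C" and ?T = "component_tree T C K" and ?d = "tree_dist T (tree_root T)"
  note A = arb_treeD(1)[OF T]
  show lab: "lab ?T = K" by (simp add: component_tree_def)
  have KV: "K \<subseteq> lab T" using reach_in_lab[OF T t(1)] K by auto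
  have tK: "t \<in> K" using K by auto
  have min: "?d t < ?d w \<or> w = t" if "w \<in> K" for w
  proof -
    have "(t, w) \<in> (arcs T)\<^sup>*" using that K rtrancl_mono[OF uncut_subset] by blast
    then obtain k where k: "(t, w) \<in> arcs T ^^ k" by (auto dest: rtrancl_imp_relpow)
    obtain n where n: "(tree_root T, t) \<in> arcs T ^^ n" using arborescence_depth[OF A t(1)] .
    then have "(tree_root T, w) \<in> arcs T ^^ (n + k)" using k by (auto simp: relpow_add)
    then have "?d w = n + k" "?d t = n" using tree_dist_depth[OF A arb_treeD(2)[OF T]] n by auto
    then show ?thesis using k by (cases k) auto
  qed
  have "arg_min ?d (\<lambda>x. x \<in> K) \<in> K \<and> (\<forall>y. y \<in> K \<longrightarrow> ?d (arg_min ?d (\<lambda>x. x \<in> K)) \<le> ?d y)"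
    by (rule arg_min_nat_lemma[of "\<lambda>x. x \<in> K", OF tK])
  then have "arg_min ?d (\<lambda>x. x \<in> K) = t" using min tK by force
  then show root: "tree_root ?T = t" by (simp add: component_tree_def arg_min_on_def)
  have "(t, w) \<in> (?B \<inter> K \<times> K)\<^sup>*" if "(t, w) \<in> ?B\<^sup>*" for w
    using that
  proof (induction rule: rtrancl_induct)
    case (step y z)
    then have "(y, z) \<in> ?B \<inter> K \<times> K" using K by (auto intro: rtrancl_into_rtrancl)
    then show ?case using step.IH by (rule rtrancl_into_rtrancl[rotated])
  qed auto
  then have "arborescence (?B \<inter> K \<times> K) (lab ?T) (tree_root ?T)"
    unfolding arborescence_def lab root
  proof (intro conjI)
    show "\<forall>u u' v. (u, v) \<in> ?B \<inter> K \<times> K \<longrightarrow> (u', v) \<in> ?B \<inter> K \<times> K \<longrightarrow> u = u'"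
      using arborescenceD(5)[OF A] uncut_subset by blast
  qed (use finite_subset[OF KV arborescenceD(1)[OF A]] tK t(2) K in auto)
  moreover have "edges ?T = undirected (?B \<inter> K \<times> K)"
    by (auto simp: component_tree_def arb_treeD(2)[OF T] undirected_def uncut_def)
  ultimately show "arb_tree ?T" "arcs ?T = ?B \<inter> K \<times> K" using arb_treeI by blast+
qed

section \<open>Admissible cuts\<close>

abbreviation kept :: "labeled_tree \<Rightarrow> nat set set \<Rightarrow> nat set" where
  "kept T C \<equiv> (uncut T C)\<^sup>* `` {tree_root T}"

lemma root_top:
  assumes "arb_tree T"
  shows "tree_root T \<in> lab T" "(u, tree_root T) \<notin> uncut T C"
  using arborescenceD(3,4)[OF arb_treeD(1)[OF assms]] by (auto simp: uncut_def)

lemma component_root: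
  assumes "arb_tree T" shows "component T C (tree_root T) = kept T C"
  by (rule component_of_top[OF assms root_top[OF assms] rtrancl_refl])

lemma path_edges_Cons: "p \<noteq> [] \<Longrightarrow> path_edges (x # p) = insert {x, hd p} (path_edges p)"
proof -
  assume p: "p \<noteq> []"
  have "e \<in> path_edges (x # p) \<longleftrightarrow> e \<in> insert {x, hd p} (path_edges p)" for e
  proof
    assume "e \<in> path_edges (x # p)"
    then obtain i where "i < length p" "e = {(x # p) ! i, p ! i}" by (auto simp: path_edges_def)
    then show "e \<in> insert {x, hd p} (path_edges p)"
    proof (cases i)
      case 0
      then show ?thesis using p \<open>e = _\<close> by (simp add: hd_conv_nth)
    next
      case (Suc j)
      then have "Suc j < length p" "e = {p ! j, p ! Suc j}"
        using \<open>i < length p\<close> \<open>e = _\<close> by simp_all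
      then show ?thesis unfolding path_edges_def by blast
    qed
  next
    assume "e \<in> insert {x, hd p} (path_edges p)"
    then show "e \<in> path_edges (x # p)"
    proof
      assume "e = {x, hd p}"
      then have "Suc 0 < length (x # p)" "e = {(x # p) ! 0, (x # p) ! Suc 0}"
        using p by (simp_all add: hd_conv_nth)
      then show ?thesis unfolding path_edges_def by blast
    next
      assume "e \<in> path_edges p"
      then obtain i where "Suc i < length p" "e = {p ! i, p ! Suc i}" by (auto simp: path_edges_def)
      then have "Suc (Suc i) < length (x # p)" "e = {(x # p) ! Suc i, (x # p) ! Suc (Suc i)}"
        by simp_all
      then show ?thesis unfolding path_edges_def by blast
    qed
  qed
  then show ?thesis by blast
qed

lemma path_edges_single: "path_edges [x] = {}" by (simp add: path_edges_def)

lemma finite_path_edges: "finite (path_edges p)"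
  by (rule finite_subset[of _ "(\<lambda>i. {p ! i, p ! Suc i}) ` {..<length p}"]) (auto simp: path_edges_def)

text \<open>Existence is shown together with two facts about the directed path: it visits only ancestors of
  \<open>v\<close>, which keeps it free of repetitions, and it uses all arcs above \<open>v\<close>.\<close>

lemma path_to_root:
  assumes T: "arb_tree T" and v: "v \<in> lab T"
  obtains p where "is_path T v p (tree_root T)"
    "\<And>x y. (x, y) \<in> arcs T \<Longrightarrow> (y, v) \<in> (arcs T)\<^sup>* \<Longrightarrow> {x, y} \<in> path_edges p"
proof -
  let ?r = "tree_root T" and ?A = "arcs T"
  note A = arb_treeD(1)[OF T]
  have "\<exists>p. is_path T v p ?r \<and> (\<forall>x\<in>set p. (x, v) \<in> ?A\<^sup>*) \<and>
      (\<forall>x y. (x, y) \<in> ?A \<longrightarrow> (y, v) \<in> ?A\<^sup>* \<longrightarrow> {x, y} \<in> path_edges p)"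
    using arborescenceD(6)[OF A v]
  proof (induction rule: rtrancl_induct)
    case base
    have "False" if "(x, y) \<in> ?A" "(y, ?r) \<in> ?A\<^sup>*" for x y
      using that(2,1) arborescenceD(4)[OF A] by (cases rule: rtranclE) auto
    then show ?case using arborescenceD(3)[OF A]
      by (intro exI[of _ "[?r]"]) (auto simp: is_path_def)
  next
    case (step w v)
    then obtain p where p: "is_path T w p ?r" "\<forall>x\<in>set p. (x, w) \<in> ?A\<^sup>*"
      "\<forall>x y. (x, y) \<in> ?A \<longrightarrow> (y, w) \<in> ?A\<^sup>* \<longrightarrow> {x, y} \<in> path_edges p" by blast
    have pne: "p \<noteq> []" "hd p = w" using p by (auto simp: is_path_def)
    have "v \<notin> set p" using arborescence_antisym[OF A] step.hyps p by blast
    moreover have "v \<in> lab T" "{v, w} \<in> edges T"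
      using step.hyps arborescenceD(2)[OF A] by (auto simp: arb_treeD(2)[OF T] doubleton_in_undirected)
    ultimately have "is_path T v (v # p) ?r"
      using p(1) by (cases p) (auto simp: is_path_def)
    moreover have "\<forall>x\<in>set (v # p). (x, v) \<in> ?A\<^sup>*" using p(2) step.hyps by (auto intro: rtrancl_into_rtrancl)
    moreover have "{x, y} \<in> path_edges (v # p)" if "(x, y) \<in> ?A" "(y, v) \<in> ?A\<^sup>*" for x y
      using that(2)
    proof (cases rule: rtranclE)
      case base
      then have "x = w" using that step.hyps arborescenceD(5)[OF A] by blast
      then show ?thesis using base pne by (auto simp: path_edges_Cons)
    next
      case (step z)
      then have "z = w" using \<open>(w, v) \<in> ?A\<close> arborescenceD(5)[OF A] by blast
      then show ?thesis using step p(3) that(1) pne by (auto simp: path_edges_Cons)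
    qed
    ultimately show ?case by blast
  qed
  then show thesis using that by blast
qed

text \<open>A descendant of \<open>v\<close> without children exists because the arcs are finite and acyclic. Its degree
  is one, unless it is the root and then the only vertex.\<close>

lemma leaf_below:
  assumes T: "arb_tree T" and v: "v \<in> lab T"
  obtains l where "leaf T l" "(v, l) \<in> (arcs T)\<^sup>*"
proof -
  note A = arb_treeD(1)[OF T]
  have "finite (arcs T)"
    using arborescenceD(1,2)[OF A] by (meson finite_SigmaI finite_subset)
  then have "wf ((arcs T)\<inverse>)"
    using arborescence_acyclic[OF A] by (simp add: finite_acyclic_wf_converse)
  then obtain l where l: "(v, l) \<in> (arcs T)\<^sup>*" "\<And>y. (l, y) \<in> arcs T \<Longrightarrow> (v, y) \<notin> (arcs T)\<^sup>*"
    by (rule wfE_min[of _ v "(arcs T)\<^sup>* `` {v}"]) auto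
  then have nochild: "(l, y) \<notin> arcs T" for y using rtrancl_into_rtrancl[OF l(1)] by blast
  have lV: "l \<in> lab T" using l(1) v arborescenceD(2)[OF A] by (induction rule: rtrancl_induct) auto
  have "leaf T l"
  proof (cases "l = tree_root T")
    case True
    have "w = l" if "w \<in> lab T" for w
      using arborescenceD(6)[OF A that]
    proof (cases rule: converse_rtranclE)
      case (step y)
      then show ?thesis using nochild True by blast
    qed (simp add: True)
    then have "lab T = {tree_root T}" using lV True by blast
    then show ?thesis using lV by (simp add: leaf_def)
  next
    case False
    obtain u where u: "(u, l) \<in> arcs T" using arborescence_parent[OF A lV False] .
    have "{e \<in> edges T. l \<in> e} = {{u, l}}"
    proof (intro equalityI subsetI)
      fix e assume "e \<in> {e \<in> edges T. l \<in> e}"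
      then obtain a b where ab: "e = {a, b}" "(a, b) \<in> arcs T" "l = a \<or> l = b"
        by (auto simp: arb_treeD(2)[OF T] undirected_def)
      then have "l = b" using nochild by blast
      then have "a = u" using ab(2) arborescenceD(5)[OF A u] by blast
      then show "e \<in> {{u, l}}" using ab(1) \<open>l = b\<close> by simp
    next
      fix e assume "e \<in> {{u, l}}"
      then show "e \<in> {e \<in> edges T. l \<in> e}"
        using u by (auto simp: arb_treeD(2)[OF T] doubleton_in_undirected)
    qed
    then show ?thesis using lV False by (simp add: leaf_def)
  qed
  then show thesis using that l by blast
qed

text \<open>This is where admissibility enters: a cut edge \<open>{u, v}\<close> with \<open>u\<close> already separated from the root would lie
  below another cut edge, and both would be on the path from some leaf to the root. So the cut
  consists exactly of the edges leaving the root component, and is determined by that component.\<close>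

lemma admissible_cut_boundary:
  assumes T: "arb_tree T" and C: "admissible_tree_cut T (Edge_Cut C)" and uv: "(u, v) \<in> arcs T"
  shows "{u, v} \<in> C \<longleftrightarrow> u \<in> kept T C \<and> v \<notin> kept T C"
proof
  note A = arb_treeD(1)[OF T]
  show "{u, v} \<in> C" if "u \<in> kept T C \<and> v \<notin> kept T C"
    using that uv by (auto simp: uncut_def intro: rtrancl_into_rtrancl)
  assume uvC: "{u, v} \<in> C"
  have v: "v \<notin> kept T C"
  proof
    assume "v \<in> kept T C"
    then have "(tree_root T, v) \<in> (uncut T C)\<^sup>*" by auto
    then show False
    proof (cases rule: rtranclE)
      case base then show ?thesis using uv arborescenceD(4)[OF A] by blast
    next
      case (step y)
      then show ?thesis using uv arborescenceD(5)[OF A] uvC by (auto simp: uncut_def)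
    qed
  qed
  have "u \<in> kept T C"
  proof (rule ccontr)
    assume nu: "u \<notin> kept T C"
    have uV: "u \<in> lab T" "v \<in> lab T" using uv arborescenceD(2)[OF A] by auto
    obtain t where t: "t \<in> lab T" "\<And>w. (w, t) \<notin> uncut T C" "(t, u) \<in> (uncut T C)\<^sup>*"
      using top_of_component[OF T uV(1)] by metis
    then have "t \<noteq> tree_root T" using nu by auto
    then obtain s where s: "(s, t) \<in> arcs T" using arborescence_parent[OF A t(1)] by metis
    then have stC: "{s, t} \<in> C" using t(2) by (auto simp: uncut_def)
    have tu: "(t, u) \<in> (arcs T)\<^sup>*" using t(3) rtrancl_mono[OF uncut_subset] by blast
    obtain l where l: "leaf T l" "(v, l) \<in> (arcs T)\<^sup>*" using leaf_below[OF T uV(2)] .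
    then have "l \<in> lab T" by (auto simp: leaf_def)
    then obtain p where p: "is_path T l p (tree_root T)"
      "\<And>x y. (x, y) \<in> arcs T \<Longrightarrow> (y, l) \<in> (arcs T)\<^sup>* \<Longrightarrow> {x, y} \<in> path_edges p"
      using path_to_root[OF T] by metis
    have "(t, l) \<in> (arcs T)\<^sup>*" using tu uv l by (meson rtrancl_into_rtrancl rtrancl_trans)
    then have "{{s, t}, {u, v}} \<subseteq> C \<inter> path_edges p" using p(2) s uv l stC uvC by auto
    moreover have "card (C \<inter> path_edges p) \<le> 1" using C l p(1) by auto
    ultimately have "{s, t} = {u, v}"
      by (metis card_le_Suc0_iff_eq One_nat_def finite_Int finite_path_edges insert_subset)
    moreover have "t \<noteq> v" using arborescence_antisym[OF A tu] uv by blast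
    ultimately have "t = u" "s = v" by (auto simp: doubleton_eq_iff)
    then show False using arborescence_antisym[OF A] s uv by blast
  qed
  then show "u \<in> kept T C \<and> v \<notin> kept T C" using v by blast
qed

text \<open>A path that goes down an arc has to keep going down, as the only way up leads back to the vertex
  it came from; but then it does not end at the root.\<close>

lemma path_to_root_ascends:
  assumes T: "arb_tree T"
    and "p \<noteq> []" "last p = tree_root T" "distinct p" "successively (\<lambda>x y. {x, y} \<in> edges T) p"
  shows "successively (\<lambda>x y. (y, x) \<in> arcs T) p"
  using assms(2-)
proof (induction p rule: induct_list012)
  case (3 x y q)
  note A = arb_treeD(1)[OF T]
  have IH: "successively (\<lambda>x y. (y, x) \<in> arcs T) (y # q)" using 3 by simp
  have "(y, x) \<in> arcs T"
  proof (rule ccontr)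
    assume "(y, x) \<notin> arcs T"
    then have xy: "(x, y) \<in> arcs T" using 3 by (auto simp: arb_treeD(2)[OF T] doubleton_in_undirected)
    show False
    proof (cases q)
      case Nil
      then show ?thesis using 3 xy arborescenceD(4)[OF A] by auto
    next
      case (Cons z q')
      then have "(z, y) \<in> arcs T" using IH by simp
      then have "z = x" using xy arborescenceD(5)[OF A] by blast
      then show ?thesis using 3 Cons by auto
    qed
  qed
  then show ?case using IH by simp
qed auto

definition closed_under :: "'a rel \<Rightarrow> 'a set \<Rightarrow> bool" where
  "closed_under A S \<longleftrightarrow> (\<forall>(u, v)\<in>A. u \<in> S \<longrightarrow> v \<in> S)"

text \<open>Conversely to the previous analysis, cut all edges that enter a descendant-closed set \<open>S\<close>. A path
  to the root ascends, so once it has left \<open>S\<close> it never returns and crosses at most one of them.\<close>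

lemma boundary_cut_admissible:
  assumes T: "arb_tree T" and S: "closed_under (arcs T) S" "S \<subseteq> lab T" "tree_root T \<notin> S"
    and C: "C = {{u, v} | u v. (u, v) \<in> arcs T \<and> u \<notin> S \<and> v \<in> S}"
  shows "admissible_tree_cut T (Edge_Cut C)" "kept T C = lab T - S"
proof -
  note A = arb_treeD(1)[OF T]
  have C_iff: "{u, v} \<in> C \<longleftrightarrow> u \<notin> S \<and> v \<in> S" if "(u, v) \<in> arcs T" for u v
    using that S(1) arborescence_antisym[OF A]
    by (auto simp: C doubleton_eq_iff closed_under_def)
  have asc: "(hd p \<notin> S \<longrightarrow> C \<inter> path_edges p = {}) \<and> card (C \<inter> path_edges p) \<le> 1"
    if "p \<noteq> []" "successively (\<lambda>x y. (y, x) \<in> arcs T) p" for p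
    using that
  proof (induction p rule: induct_list012)
    case (2 x) then show ?case by (simp add: path_edges_single)
  next
    case (3 x y q)
    then have yx: "(y, x) \<in> arcs T" by simp
    have IH: "y \<notin> S \<Longrightarrow> C \<inter> path_edges (y # q) = {}" "card (C \<inter> path_edges (y # q)) \<le> 1"
      using 3 by auto
    have pe: "path_edges (x # y # q) = insert {y, x} (path_edges (y # q))"
      by (simp add: path_edges_Cons insert_commute)
    show ?case
    proof (cases "{y, x} \<in> C")
      case True
      then show ?thesis using C_iff[OF yx] IH pe by auto
    next
      case False
      moreover have "y \<notin> S" if "x \<notin> S" using that yx S(1) by (auto simp: closed_under_def)
      ultimately show ?thesis using IH pe by auto
    qed
  qed auto
  have "C \<subseteq> edges T" by (auto simp: C arb_treeD(2)[OF T] undirected_def)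
  then show "admissible_tree_cut T (Edge_Cut C)"
    using asc path_to_root_ascends[OF T] by (auto simp: is_path_def)
  have "v \<in> lab T - S" if "(tree_root T, v) \<in> (uncut T C)\<^sup>*" for v
    using that
  proof (induction rule: rtrancl_induct)
    case base then show ?case using S arborescenceD(3)[OF A] by auto
  next
    case (step y z)
    then have "(y, z) \<in> arcs T" "{y, z} \<notin> C" by (auto simp: uncut_def)
    then show ?case using step C_iff arborescenceD(2)[OF A] by auto
  qed
  moreover have "v \<notin> S \<longrightarrow> (tree_root T, v) \<in> (uncut T C)\<^sup>*" if "v \<in> lab T" for v
    using arborescenceD(6)[OF A that]
  proof (induction rule: rtrancl_induct)
    case (step y z)
    show ?case
    proof
      assume z: "z \<notin> S"
      then have "y \<notin> S" using step S(1) by (auto simp: closed_under_def)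
      moreover have "(y, z) \<in> uncut T C" using step z C_iff by (auto simp: uncut_def)
      ultimately show "(tree_root T, z) \<in> (uncut T C)\<^sup>*" using step by (auto intro: rtrancl_into_rtrancl)
    qed
  qed auto
  ultimately show "kept T C = lab T - S" by auto
qed

lemma kept_complement_closed:
  assumes T: "arb_tree T"
  shows "closed_under (arcs T) (lab T - kept T C)"
proof -
  note A = arb_treeD(1)[OF T]
  have "v \<in> lab T - kept T C" if uv: "(u, v) \<in> arcs T" "u \<in> lab T - kept T C" for u v
  proof -
    have "(tree_root T, v) \<notin> (uncut T C)\<^sup>*"
    proof
      assume "(tree_root T, v) \<in> (uncut T C)\<^sup>*"
      then show False
      proof (cases rule: rtranclE)
        case base then show ?thesis using uv arborescenceD(4)[OF A] by blast
      next
        case (step y)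
        then have "y = u" using uv arborescenceD(5)[OF A] uncut_subset by blast
        then show ?thesis using step uv by auto
      qed
    qed
    then show ?thesis using uv arborescenceD(2)[OF A] by auto
  qed
  then show ?thesis unfolding closed_under_def by blast
qed

lemma component_subset: "component T C v \<subseteq> lab T"
  by (auto simp: component_def)

lemma component_self: "v \<in> lab T \<Longrightarrow> v \<in> component T C v"
  by (auto simp: component_def)

lemma component_eq:
  assumes T: "arb_tree T" and "v \<in> lab T" "w \<in> component T C v"
  shows "component T C w = component T C v"
proof -
  obtain t where t: "t \<in> lab T" "\<And>u. (u, t) \<notin> uncut T C" "(t, v) \<in> (uncut T C)\<^sup>*"
    using top_of_component[OF T assms(2)] by metis
  note K = component_of_top[OF T t]
  then have "(t, w) \<in> (uncut T C)\<^sup>*" using assms(3) by auto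
  then show ?thesis using component_of_top[OF T t(1,2)] K by simp
qed

definition forest_arcs :: "forest \<Rightarrow> nat rel" where
  "forest_arcs F = (\<Union>T\<in>F. arcs T)"

definition arb_forest :: "forest \<Rightarrow> bool" where
  "arb_forest F \<longleftrightarrow> (\<forall>T\<in>F. arb_tree T) \<and> disjoint_family_on lab F"

lemma labeled_rooted_forest_arb_forest: "labeled_rooted_forest F \<Longrightarrow> arb_forest F"
  by (simp add: labeled_rooted_forest_def arb_forest_def labeled_rooted_tree_arb_tree)

lemma arb_forestD:
  assumes "arb_forest F"
  shows "T \<in> F \<Longrightarrow> arb_tree T" "T \<in> F \<Longrightarrow> T' \<in> F \<Longrightarrow> v \<in> lab T \<Longrightarrow> v \<in> lab T' \<Longrightarrow> T = T'"
  using assms by (auto simp: arb_forest_def disjoint_family_on_def)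

lemma arcs_in_lab:
  assumes "arb_tree T" "(u, v) \<in> arcs T"
  shows "u \<in> lab T \<and> v \<in> lab T"
  using arborescenceD(2)[OF arb_treeD(1)[OF assms(1)]] assms(2) by blast

lemma forest_arcs_in_tree:
  assumes F: "arb_forest F" and T: "T \<in> F" and uv: "(u, v) \<in> forest_arcs F" and "u \<in> lab T \<or> v \<in> lab T"
  shows "(u, v) \<in> arcs T" "u \<in> lab T" "v \<in> lab T"
proof -
  obtain T' where T': "T' \<in> F" "(u, v) \<in> arcs T'" using uv by (auto simp: forest_arcs_def)
  then have "u \<in> lab T'" "v \<in> lab T'" using arcs_in_lab arb_forestD(1)[OF F] by blast+
  then have "T' = T" using assms(4) arb_forestD(2)[OF F T'(1) T] by blast
  then show "(u, v) \<in> arcs T" "u \<in> lab T" "v \<in> lab T" using T' \<open>u \<in> _\<close> \<open>v \<in> _\<close> by simp_all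
qed

lemma forest_arcs_subset:
  assumes "arb_forest F" shows "forest_arcs F \<subseteq> verts F \<times> verts F"
  using arcs_in_lab[OF arb_forestD(1)[OF assms]] by (fastforce simp: forest_arcs_def verts_def)

text \<open>Both parts of a cut are families of components, so they are treated together: \<open>\<K>\<close> is the family
  of all components but that of the root, or the component of the root alone.\<close>

lemma components_forest:
  assumes T: "arb_tree T" and \<K>: "\<K> \<subseteq> component T C ` lab T"
  shows "arb_forest (component_tree T C ` \<K>)" "verts (component_tree T C ` \<K>) = \<Union>\<K>"
    "forest_arcs (component_tree T C ` \<K>) = uncut T C \<inter> \<Union>\<K> \<times> \<Union>\<K>"
proof -
  have lab: "lab (component_tree T C K) = K" for K by (simp add: component_tree_def)
  have K: "arb_tree (component_tree T C K) \<and> arcs (component_tree T C K) = uncut T C \<inter> K \<times> K \<and>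
      (\<forall>u v. (u, v) \<in> uncut T C \<longrightarrow> u \<in> K \<longrightarrow> v \<in> K)"
    if K: "K \<in> \<K>" for K
  proof -
    obtain v where v: "v \<in> lab T" "K = component T C v" using \<K> K by blast
    obtain t where t: "t \<in> lab T" "\<And>u. (u, t) \<notin> uncut T C" "(t, v) \<in> (uncut T C)\<^sup>*"
      using top_of_component[OF T v(1)] by metis
    then have eq: "K = (uncut T C)\<^sup>* `` {t}" using component_of_top[OF T t] v by simp
    then show ?thesis using component_tree_arb_tree(1,2)[OF T t(1,2) eq]
      by (auto intro: rtrancl_into_rtrancl)
  qed
  have disj: "K = K'" if KK': "K \<in> \<K>" "K' \<in> \<K>" and w: "w \<in> K" "w \<in> K'" for K K' w
  proof -
    obtain v v' where "v \<in> lab T" "K = component T C v" "v' \<in> lab T" "K' = component T C v'"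
      using \<K> KK' by blast
    then show ?thesis using component_eq[OF T] w by metis
  qed
  show "arb_forest (component_tree T C ` \<K>)"
    unfolding arb_forest_def disjoint_family_on_def
  proof (intro conjI ballI impI)
    fix U U' assume "U \<in> component_tree T C ` \<K>" "U' \<in> component_tree T C ` \<K>" "U \<noteq> U'"
    then obtain K K' where "K \<in> \<K>" "K' \<in> \<K>" "K \<noteq> K'" "lab U = K" "lab U' = K'"
      using lab by blast
    then show "lab U \<inter> lab U' = {}" using disj by blast
  qed (use K in blast)
  show "verts (component_tree T C ` \<K>) = \<Union>\<K>" by (simp add: verts_def lab)
  have "forest_arcs (component_tree T C ` \<K>) = (\<Union>K\<in>\<K>. uncut T C \<inter> K \<times> K)"
    using K by (auto simp: forest_arcs_def)
  also have "\<dots> = uncut T C \<inter> \<Union>\<K> \<times> \<Union>\<K>" using K by blast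
  finally show "forest_arcs (component_tree T C ` \<K>) = uncut T C \<inter> \<Union>\<K> \<times> \<Union>\<K>" .
qed

lemma tree_cut_verts:
  assumes T: "arb_tree T"
  shows "verts (P_tree (Edge_Cut C) T) = lab T - kept T C"
    "verts (R_tree (Edge_Cut C) T) = kept T C"
proof -
  let ?\<K> = "component T C ` lab T"
  have r: "tree_root T \<in> lab T" using root_top[OF T] by blast
  have kept: "kept T C \<in> ?\<K>" using component_root[OF T] r by force
  have "\<Union>(?\<K> - {kept T C}) = lab T - kept T C"
  proof (intro equalityI subsetI)
    fix w assume "w \<in> \<Union>(?\<K> - {kept T C})"
    then obtain v where v: "v \<in> lab T" "component T C v \<noteq> kept T C" "w \<in> component T C v" by auto
    have "w \<notin> kept T C"
      using component_eq[OF T v(1,3)] component_eq[OF T r] v(2) component_root[OF T] by metis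
    then show "w \<in> lab T - kept T C" using v component_subset by blast
  next
    fix w assume w: "w \<in> lab T - kept T C"
    then have "w \<in> component T C w" "component T C w \<noteq> kept T C"
      using component_self[of w T C] by auto
    then show "w \<in> \<Union>(?\<K> - {kept T C})" using w by blast
  qed
  then show "verts (P_tree (Edge_Cut C) T) = lab T - kept T C"
    by (simp add: components_forest(2)[OF T] component_root[OF T])
  show "verts (R_tree (Edge_Cut C) T) = kept T C"
    by (simp add: verts_def component_tree_def component_root[OF T])
qed

text \<open>Since the edges of an admissible cut are those between kept and cut-off vertices, no arc inside
  either part is lost.\<close>

lemma tree_cut_parts:
  assumes T: "arb_tree T" and c: "admissible_tree_cut T c"
  defines "S \<equiv> verts (P_tree c T)"
  shows "arb_forest (P_tree c T)" "arb_forest (R_tree c T)" "S \<subseteq> lab T" "verts (R_tree c T) = lab T - S"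
    "forest_arcs (P_tree c T) = arcs T \<inter> S \<times> S"
    "forest_arcs (R_tree c T) = arcs T \<inter> (lab T - S) \<times> (lab T - S)"
proof -
  have "arb_forest (P_tree c T) \<and> arb_forest (R_tree c T) \<and> S \<subseteq> lab T \<and> verts (R_tree c T) = lab T - S \<and>
    forest_arcs (P_tree c T) = arcs T \<inter> S \<times> S \<and>
    forest_arcs (R_tree c T) = arcs T \<inter> (lab T - S) \<times> (lab T - S)"
  proof (cases c)
    case Full_Cut
    then show ?thesis using T arcs_in_lab[OF T]
      by (auto simp: S_def arb_forest_def verts_def forest_arcs_def disjoint_family_on_def)
  next
    case (Edge_Cut C)
    let ?\<K> = "component T C ` lab T"
    have r: "tree_root T \<in> lab T" using root_top[OF T] by blast
    then have kept: "kept T C \<in> ?\<K>" using component_root[OF T] by force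
    have kV: "kept T C \<subseteq> lab T" using component_subset component_root[OF T] by metis
    have S: "S = lab T - kept T C" by (simp only: S_def Edge_Cut tree_cut_verts(1)[OF T])
    then have comp: "lab T - S = kept T C" using kV by blast
    have P: "P_tree c T = component_tree T C ` (?\<K> - {kept T C})"
      and R: "R_tree c T = component_tree T C ` {kept T C}"
      by (simp_all add: Edge_Cut component_root[OF T])
    have bd: "{u, v} \<in> C \<longleftrightarrow> u \<in> kept T C \<and> v \<notin> kept T C" if "(u, v) \<in> arcs T" for u v
      using admissible_cut_boundary[OF T _ that] c Edge_Cut by blast
    have sub: "?\<K> - {kept T C} \<subseteq> ?\<K>" "{kept T C} \<subseteq> ?\<K>" using kept by auto
    have "forest_arcs (P_tree c T) = uncut T C \<inter> S \<times> S"
      using components_forest(2,3)[OF T sub(1)] unfolding P[symmetric] S_def[symmetric] by simp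
    also have "\<dots> = arcs T \<inter> S \<times> S" using bd by (auto simp: uncut_def S)
    finally have aP: "forest_arcs (P_tree c T) = arcs T \<inter> S \<times> S" .
    have "forest_arcs (R_tree c T) = uncut T C \<inter> kept T C \<times> kept T C"
      using components_forest(3)[OF T sub(2)] unfolding R by simp
    also have "\<dots> = arcs T \<inter> kept T C \<times> kept T C" using bd by (auto simp: uncut_def)
    finally have aR: "forest_arcs (R_tree c T) = arcs T \<inter> kept T C \<times> kept T C" .
    have "arb_forest (P_tree c T)" "arb_forest (R_tree c T)"
      unfolding P R using components_forest(1)[OF T] sub by blast+
    moreover have "verts (R_tree c T) = kept T C" by (simp only: Edge_Cut tree_cut_verts(2)[OF T])
    ultimately show ?thesis using aP aR comp S by auto
  qed
  then show "arb_forest (P_tree c T)" "arb_forest (R_tree c T)" "S \<subseteq> lab T" "verts (R_tree c T) = lab T - S"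
    "forest_arcs (P_tree c T) = arcs T \<inter> S \<times> S"
    "forest_arcs (R_tree c T) = arcs T \<inter> (lab T - S) \<times> (lab T - S)" by blast+
qed

text \<open>The set \<open>lab T\<close> comes from the full cut, as it is the only closed set that contains the root; any
  other closed set comes from the cut along its boundary.\<close>

lemma tree_cut_bij:
  assumes T: "arb_tree T"
  shows "bij_betw (\<lambda>c. verts (P_tree c T)) {c. admissible_tree_cut T c}
           {S. S \<subseteq> lab T \<and> closed_under (arcs T) S}"
proof -
  let ?\<Phi> = "\<lambda>c. verts (P_tree c T)"
  note A = arb_treeD(1)[OF T]
  have full: "?\<Phi> Full_Cut = lab T" by (simp add: verts_def)
  have r: "tree_root T \<in> lab T" "\<And>C. tree_root T \<in> kept T C" using root_top[OF T] by auto
  have sub: "kept T C \<subseteq> lab T" for C using component_subset component_root[OF T] by metis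
  have edge: "C = {{u, v} | u v. (u, v) \<in> arcs T \<and> u \<in> kept T C \<and> v \<notin> kept T C}"
    if "admissible_tree_cut T (Edge_Cut C)" for C
  proof -
    have "C \<subseteq> undirected (arcs T)" using that arb_treeD(2)[OF T] by simp
    then have "C = {{u, v} | u v. (u, v) \<in> arcs T \<and> {u, v} \<in> C}" unfolding undirected_def by blast
    also have "\<dots> = {{u, v} | u v. (u, v) \<in> arcs T \<and> u \<in> kept T C \<and> v \<notin> kept T C}"
      using admissible_cut_boundary[OF T that] by blast
    finally show ?thesis .
  qed
  have "inj_on ?\<Phi> {c. admissible_tree_cut T c}"
  proof (rule inj_onI, clarify)
    fix c c' assume c: "admissible_tree_cut T c" "admissible_tree_cut T c'" "?\<Phi> c = ?\<Phi> c'"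
    have ne: "?\<Phi> (Edge_Cut C) \<noteq> lab T" for C using r unfolding tree_cut_verts[OF T] by blast
    show "c = c'"
    proof (cases c)
      case Full_Cut
      then show ?thesis using c(3) ne full by (cases c') (auto simp del: P_tree.simps)
    next
      case (Edge_Cut C)
      then obtain C' where C': "c' = Edge_Cut C'"
        using c(3) ne full by (cases c') (auto simp del: P_tree.simps)
      then have "lab T - kept T C = lab T - kept T C'"
        using c(3) Edge_Cut tree_cut_verts(1)[OF T] by simp
      then have "kept T C = kept T C'" using sub by blast
      then have "C = C'" using edge[of C] edge[of C'] c(1,2) Edge_Cut C' by simp
      then show ?thesis using Edge_Cut C' by simp
    qed
  qed
  moreover have "?\<Phi> ` {c. admissible_tree_cut T c} = {S. S \<subseteq> lab T \<and> closed_under (arcs T) S}"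
  proof (intro equalityI subsetI)
    fix S assume "S \<in> ?\<Phi> ` {c. admissible_tree_cut T c}"
    then obtain c where c: "S = ?\<Phi> c" by blast
    have "closed_under (arcs T) (lab T)" using arcs_in_lab[OF T] by (auto simp: closed_under_def)
    then show "S \<in> {S. S \<subseteq> lab T \<and> closed_under (arcs T) S}"
      using c full tree_cut_verts(1)[OF T] kept_complement_closed[OF T]
      by (cases c) (simp_all del: P_tree.simps)
  next
    fix S assume "S \<in> {S. S \<subseteq> lab T \<and> closed_under (arcs T) S}"
    then have S: "closed_under (arcs T) S" "S \<subseteq> lab T" by auto
    show "S \<in> ?\<Phi> ` {c. admissible_tree_cut T c}"
    proof (cases "tree_root T \<in> S")
      case True
      have "v \<in> S" if "v \<in> lab T" for v
        using arborescenceD(6)[OF A that] True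
        by (induction rule: rtrancl_induct) (use S(1) in \<open>auto simp: closed_under_def\<close>)
      then have "S = ?\<Phi> Full_Cut" using S full by auto
      moreover have "admissible_tree_cut T Full_Cut" by simp
      ultimately show ?thesis by blast
    next
      case False
      define C where "C = {{u, v} | u v. (u, v) \<in> arcs T \<and> u \<notin> S \<and> v \<in> S}"
      have "admissible_tree_cut T (Edge_Cut C)" "kept T C = lab T - S"
        using boundary_cut_admissible[OF T S False C_def] by auto
      moreover have "?\<Phi> (Edge_Cut C) = S"
        using \<open>kept T C = _\<close> tree_cut_verts(1)[OF T] S(2) by auto
      ultimately show ?thesis by blast
    qed
  qed
  ultimately show ?thesis by (simp add: bij_betw_def)
qed

section \<open>Cuts of forests\<close>

lemma admissible_cutsD: "C \<in> admissible_cuts F \<Longrightarrow> T \<in> F \<Longrightarrow> admissible_tree_cut T (C T)"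
  by (auto simp: admissible_cuts_def)

lemma verts_Union: "verts (\<Union>T\<in>F. Q T) = (\<Union>T\<in>F. verts (Q T))" by (auto simp: verts_def)
lemma forest_arcs_Union: "forest_arcs (\<Union>T\<in>F. Q T) = (\<Union>T\<in>F. forest_arcs (Q T))" by (auto simp: forest_arcs_def)

lemma arb_forest_Union:
  assumes F: "arb_forest F" and Q: "\<And>T. T \<in> F \<Longrightarrow> arb_forest (Q T)" "\<And>T. T \<in> F \<Longrightarrow> verts (Q T) \<subseteq> lab T"
  shows "arb_forest (\<Union>T\<in>F. Q T)"
  unfolding arb_forest_def disjoint_family_on_def
proof (intro conjI ballI impI)
  fix U assume "U \<in> (\<Union>T\<in>F. Q T)"
  then show "arb_tree U" using Q(1) arb_forestD(1) by blast
next
  fix U U' assume U: "U \<in> (\<Union>T\<in>F. Q T)" "U' \<in> (\<Union>T\<in>F. Q T)" "U \<noteq> U'"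
  then obtain T T' where T: "T \<in> F" "U \<in> Q T" "T' \<in> F" "U' \<in> Q T'" by blast
  then have sub: "lab U \<subseteq> lab T" "lab U' \<subseteq> lab T'" using Q(2) by (auto simp: verts_def)
  show "lab U \<inter> lab U' = {}"
  proof (rule equals0I)
    fix v assume v: "v \<in> lab U \<inter> lab U'"
    then have "T = T'" using sub arb_forestD(2)[OF F] T by blast
    then show False using arb_forestD(2)[OF Q(1)] T v U(3) by blast
  qed
qed

lemma cut_verts_tree:
  assumes F: "arb_forest F" and C: "C \<in> admissible_cuts F" and T: "T \<in> F"
  shows "verts (P C F) \<inter> lab T = verts (P_tree (C T) T)"
proof -
  have "verts (P_tree (C T') T') \<subseteq> lab T'" if "T' \<in> F" for T'
    using tree_cut_parts(3)[OF arb_forestD(1)[OF F that] admissible_cutsD[OF C that]] .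
  then show ?thesis using arb_forestD(2)[OF F] T unfolding P_def verts_Union by blast
qed

lemma cut_parts:
  assumes F: "arb_forest F" and C: "C \<in> admissible_cuts F"
  defines "S \<equiv> verts (P C F)"
  shows "arb_forest (P C F)" "arb_forest (R C F)" "S \<subseteq> verts F" "verts (R C F) = verts F - S"
    "forest_arcs (P C F) = forest_arcs F \<inter> S \<times> S"
    "forest_arcs (R C F) = forest_arcs F \<inter> (verts F - S) \<times> (verts F - S)"
proof -
  note parts = tree_cut_parts[OF arb_forestD(1)[OF F] admissible_cutsD[OF C]]
  have ST: "verts (P_tree (C T) T) = S \<inter> lab T" if "T \<in> F" for T
    using cut_verts_tree[OF F C that] by (simp add: S_def)
  show "arb_forest (P C F)" unfolding P_def using parts by (intro arb_forest_Union F)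
  show "arb_forest (R C F)" unfolding R_def using parts(2,4) by (intro arb_forest_Union F) auto
  show S: "S \<subseteq> verts F"
    using parts(3) unfolding S_def P_def verts_Union by (auto simp: verts_def)
  have "verts (R C F) = (\<Union>T\<in>F. lab T - S \<inter> lab T)"
    unfolding R_def verts_Union using parts(4) ST by simp
  then show "verts (R C F) = verts F - S" by (auto simp: verts_def)
  have "forest_arcs (P C F) = (\<Union>T\<in>F. arcs T \<inter> (S \<inter> lab T) \<times> (S \<inter> lab T))"
    unfolding P_def forest_arcs_Union using parts(5) ST by simp
  also have "\<dots> = forest_arcs F \<inter> S \<times> S"
    using arcs_in_lab[OF arb_forestD(1)[OF F]] unfolding forest_arcs_def by blast
  finally show "forest_arcs (P C F) = forest_arcs F \<inter> S \<times> S" .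
  have "forest_arcs (R C F) = (\<Union>T\<in>F. arcs T \<inter> (lab T - S \<inter> lab T) \<times> (lab T - S \<inter> lab T))"
    unfolding R_def forest_arcs_Union using parts(6) ST by simp
  also have "\<dots> = forest_arcs F \<inter> (verts F - S) \<times> (verts F - S)"
    using arcs_in_lab[OF arb_forestD(1)[OF F]] unfolding forest_arcs_def verts_def by blast
  finally show "forest_arcs (R C F) = forest_arcs F \<inter> (verts F - S) \<times> (verts F - S)" .
qed

lemma cut_closed:
  assumes F: "arb_forest F" and C: "C \<in> admissible_cuts F"
  shows "closed_under (forest_arcs F) (verts (P C F))"
proof -
  have "v \<in> verts (P C F)" if uv: "(u, v) \<in> forest_arcs F" and u: "u \<in> verts (P C F)" for u v
  proof -
    obtain T where T: "T \<in> F" "u \<in> lab T" using u cut_parts(3)[OF F C] by (auto simp: verts_def)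
    note uvT = forest_arcs_in_tree[OF F T(1) uv]
    have "closed_under (arcs T) (verts (P_tree (C T) T))"
      using bij_betwE[OF tree_cut_bij[OF arb_forestD(1)[OF F T(1)]]] admissible_cutsD[OF C T(1)] by blast
    then show ?thesis using cut_verts_tree[OF F C T(1)] u T uvT
      by (auto simp: closed_under_def)
  qed
  then show ?thesis by (auto simp: closed_under_def)
qed

lemma cut_unique:
  assumes F: "arb_forest F" and C: "C \<in> admissible_cuts F" "C' \<in> admissible_cuts F"
    and eq: "verts (P C F) = verts (P C' F)"
  shows "C = C'"
proof (rule PiE_ext)
  show "C \<in> (\<Pi>\<^sub>E T\<in>F. {c. admissible_tree_cut T c})" "C' \<in> (\<Pi>\<^sub>E T\<in>F. {c. admissible_tree_cut T c})"
    using C by (auto simp: admissible_cuts_def)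
  fix T assume T: "T \<in> F"
  have "verts (P_tree (C T) T) = verts (P_tree (C' T) T)"
    using cut_verts_tree[OF F _ T] C eq by metis
  then show "C T = C' T"
    using bij_betw_imp_inj_on[OF tree_cut_bij[OF arb_forestD(1)[OF F T]]] admissible_cutsD[OF _ T] C
    by (auto dest: inj_onD)
qed

lemma cut_exists:
  assumes F: "arb_forest F" and S: "S \<subseteq> verts F" "closed_under (forest_arcs F) S"
  obtains C where "C \<in> admissible_cuts F" "verts (P C F) = S"
proof -
  have "\<exists>c. admissible_tree_cut T c \<and> verts (P_tree c T) = S \<inter> lab T" if T: "T \<in> F" for T
  proof -
    have "closed_under (arcs T) (S \<inter> lab T)"
      using S(2) T arcs_in_lab[OF arb_forestD(1)[OF F T]] unfolding closed_under_def forest_arcs_def by blast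
    then have "S \<inter> lab T \<in> {S. S \<subseteq> lab T \<and> closed_under (arcs T) S}" by blast
    then show ?thesis
      unfolding bij_betw_imp_surj_on[OF tree_cut_bij[OF arb_forestD(1)[OF F T]], symmetric] by blast
  qed
  then obtain c where c: "\<And>T. T \<in> F \<Longrightarrow> admissible_tree_cut T (c T) \<and> verts (P_tree (c T) T) = S \<inter> lab T"
    by metis
  have "restrict c F \<in> admissible_cuts F" using c by (auto simp: admissible_cuts_def)
  moreover have "verts (P (restrict c F) F) = S"
    using c S(1) unfolding P_def verts_Union by (auto simp: verts_def)
  ultimately show thesis using that by blast
qed

lemma ex1_cuts_off:
  assumes "arb_forest F" "S \<subseteq> verts F" "closed_under (forest_arcs F) S"
  shows "\<exists>!E. cuts_off F S E"
  using cut_exists[OF assms] cut_unique[OF assms(1)] unfolding cuts_off_def by metis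

section \<open>Isomorphisms of forests\<close>

lemma arborescence_image:
  assumes A: "arborescence A V r" and f: "inj_on f V"
  shows "arborescence (map_prod f f ` A) (f ` V) (f r)"
  unfolding arborescence_def
proof (intro conjI allI impI ballI)
  note AV = arborescenceD(2)[OF A]
  show "finite (f ` V)" "f r \<in> f ` V" using arborescenceD(1,3)[OF A] by auto
  show "map_prod f f ` A \<subseteq> f ` V \<times> f ` V" using AV by auto
  show "(u, f r) \<notin> map_prod f f ` A" for u
  proof
    assume "(u, f r) \<in> map_prod f f ` A"
    then obtain a b where ab: "(a, b) \<in> A" "f b = f r" by auto
    then have "b = r" using f AV arborescenceD(3)[OF A] by (auto dest: inj_onD)
    then show False using ab arborescenceD(4)[OF A] by blast
  qed
  fix u u' v assume "(u, v) \<in> map_prod f f ` A" "(u', v) \<in> map_prod f f ` A"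
  then obtain a b a' b' where ab: "(a, b) \<in> A" "(a', b') \<in> A" "f b = f b'" "u = f a" "u' = f a'" by auto
  then have "b = b'" using f AV by (auto dest: inj_onD)
  then show "u = u'" using ab arborescenceD(5)[OF A] by blast
next
  fix w assume "w \<in> f ` V"
  then obtain v where v: "v \<in> V" "w = f v" by blast
  have "(f r, f v) \<in> (map_prod f f ` A)\<^sup>*"
    using arborescenceD(6)[OF A v(1)]
  proof (induction rule: rtrancl_induct)
    case (step y z)
    then have "(f y, f z) \<in> map_prod f f ` A" by force
    then show ?case using step.IH by (rule rtrancl_into_rtrancl[rotated])
  qed auto
  then show "(f r, w) \<in> (map_prod f f ` A)\<^sup>*" using v by simp
qed

text \<open>The image of the arcs is an arborescence orienting the edges of \<open>T'\<close> from its root, so by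
  uniqueness it consists of the arcs of \<open>T'\<close>.\<close>

lemma tree_iso_arcs:
  assumes T: "arb_tree T" and T': "arb_tree T'" and f: "tree_iso f T T'"
  shows "arcs T' = map_prod f f ` arcs T"
proof (rule arb_treeI(2))
  note A = arb_treeD(1)[OF T]
  have bij: "inj_on f (lab T)" "f ` lab T = lab T'" and root: "f (tree_root T) = tree_root T'"
    and e: "\<And>u v. u \<in> lab T \<Longrightarrow> v \<in> lab T \<Longrightarrow> {u, v} \<in> edges T \<longleftrightarrow> {f u, f v} \<in> edges T'"
    using f unfolding tree_iso_def bij_betw_def by blast+
  show "arborescence (map_prod f f ` arcs T) (lab T') (tree_root T')"
    using arborescence_image[OF A bij(1)] by (simp add: bij root)
  show "edges T' = undirected (map_prod f f ` arcs T)"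
  proof (intro equalityI subsetI)
    fix x assume x: "x \<in> edges T'"
    then obtain a b where ab: "x = {a, b}" "(a, b) \<in> arcs T'" using arb_treeD(2)[OF T'] by (auto simp: undirected_def)
    then obtain u v where uv: "u \<in> lab T" "v \<in> lab T" "a = f u" "b = f v"
      using arcs_in_lab[OF T'] bij(2) by blast
    then have "(u, v) \<in> arcs T \<or> (v, u) \<in> arcs T"
      using e[OF uv(1,2)] x ab arb_treeD(2)[OF T] by (simp add: doubleton_in_undirected)
    then have "(a, b) \<in> map_prod f f ` arcs T \<or> (b, a) \<in> map_prod f f ` arcs T" using uv by force
    then show "x \<in> undirected (map_prod f f ` arcs T)" using ab by (simp add: doubleton_in_undirected)
  next
    fix x assume "x \<in> undirected (map_prod f f ` arcs T)"
    then obtain u v where uv: "(u, v) \<in> arcs T" "x = {f u, f v}" by (auto simp: undirected_def)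
    then have "u \<in> lab T" "v \<in> lab T" "{u, v} \<in> edges T"
      using arcs_in_lab[OF T] arb_treeD(2)[OF T] by (auto simp: doubleton_in_undirected)
    then show "x \<in> edges T'" using e uv by blast
  qed
qed

lemma tree_of_vertex:
  assumes "v \<in> verts F" obtains T where "T \<in> F" "v \<in> lab T"
  using assms by (auto simp: verts_def)

text \<open>For the converse direction, the matching of the trees is recovered from the bijection of vertices:
  a root is a vertex without incoming arc, so roots go to roots, and the vertices of a tree are the
  descendants of its root, so trees go to trees.\<close>

lemma forest_iso_iff:
  assumes F: "arb_forest F" and F': "arb_forest F'"
  shows "forest_iso f F F' \<longleftrightarrow> bij_betw f (verts F) (verts F') \<and>
    (\<forall>u\<in>verts F. \<forall>v\<in>verts F. (u, v) \<in> forest_arcs F \<longleftrightarrow> (f u, f v) \<in> forest_arcs F')" (is "?L \<longleftrightarrow> ?R")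
proof
  assume ?L
  then obtain m where f: "bij_betw f (verts F) (verts F')" and m: "bij_betw m F F'"
    and iso: "\<And>T. T \<in> F \<Longrightarrow> tree_iso f T (m T)"
    by (auto simp: forest_iso_def)
  have mF: "m T \<in> F'" if "T \<in> F" for T using m that by (auto simp: bij_betw_def)
  have arcs: "arcs (m T) = map_prod f f ` arcs T" if "T \<in> F" for T
    using tree_iso_arcs[OF arb_forestD(1)[OF F that] arb_forestD(1)[OF F' mF[OF that]] iso[OF that]] .
  have "(u, v) \<in> forest_arcs F \<longleftrightarrow> (f u, f v) \<in> forest_arcs F'" if u: "u \<in> verts F" and v: "v \<in> verts F" for u v
  proof
    assume "(u, v) \<in> forest_arcs F"
    then obtain T where "T \<in> F" "(u, v) \<in> arcs T" by (auto simp: forest_arcs_def)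
    then have "(f u, f v) \<in> arcs (m T)" "m T \<in> F'" using arcs mF by force+
    then show "(f u, f v) \<in> forest_arcs F'" by (auto simp: forest_arcs_def)
  next
    assume fuv: "(f u, f v) \<in> forest_arcs F'"
    obtain T where T: "T \<in> F" "u \<in> lab T" using tree_of_vertex[OF u] .
    then have "f u \<in> lab (m T)" using iso[OF T(1)] by (auto simp: tree_iso_def bij_betw_def)
    then have "(f u, f v) \<in> arcs (m T)" using forest_arcs_in_tree(1)[OF F' mF[OF T(1)] fuv] by blast
    then obtain a b where ab: "(a, b) \<in> arcs T" "f a = f u" "f b = f v" using arcs[OF T(1)] by auto
    then have "(a, b) \<in> forest_arcs F" using T by (auto simp: forest_arcs_def)
    moreover have "a = u" "b = v"
      using forest_arcs_subset[OF F] calculation u v ab f by (auto simp: bij_betw_def dest: inj_onD)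
    ultimately show "(u, v) \<in> forest_arcs F" by simp
  qed
  then show ?R using f by blast
next
  assume R: ?R
  then have f: "inj_on f (verts F)" "f ` verts F = verts F'" by (auto simp: bij_betw_def)
  have arc: "(u, v) \<in> forest_arcs F \<longleftrightarrow> (f u, f v) \<in> forest_arcs F'" if "u \<in> verts F" "v \<in> verts F" for u v
    using R that by blast
  have fV: "f v \<in> verts F'" if "v \<in> verts F" for v using f that by blast
  have "\<exists>T'\<in>F'. tree_iso f T T'" if T: "T \<in> F" for T
  proof -
    note tT = arb_forestD(1)[OF F T]
    note A = arb_treeD(1)[OF tT]
    have V: "lab T \<subseteq> verts F" using T by (auto simp: verts_def)
    let ?r = "tree_root T"
    have r: "?r \<in> lab T" using arborescenceD(3)[OF A] .
    obtain T' where T': "T' \<in> F'" "f ?r \<in> lab T'" using tree_of_vertex fV r V by blast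
    note tT' = arb_forestD(1)[OF F' T'(1)]
    note A' = arb_treeD(1)[OF tT']
    have V': "lab T' \<subseteq> verts F'" using T' by (auto simp: verts_def)
    have arcsT: "(u, v) \<in> arcs T \<longleftrightarrow> (u, v) \<in> forest_arcs F" if "u \<in> lab T \<or> v \<in> lab T" for u v
      using forest_arcs_in_tree(1)[OF F T] that T by (auto simp: forest_arcs_def)
    have arcsT': "(u, v) \<in> arcs T' \<longleftrightarrow> (u, v) \<in> forest_arcs F'" if "u \<in> lab T' \<or> v \<in> lab T'" for u v
      using forest_arcs_in_tree(1)[OF F' T'(1)] that T' by (auto simp: forest_arcs_def)
    have root: "f ?r = tree_root T'"
    proof (rule ccontr)
      assume "f ?r \<noteq> tree_root T'"
      then obtain x where x: "(x, f ?r) \<in> arcs T'" using arborescence_parent[OF A' T'(2)] by blast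
      then have "x \<in> lab T'" using arcs_in_lab[OF tT'] by blast
      then obtain u where u: "u \<in> verts F" "x = f u" using V' f by blast
      then have "(u, ?r) \<in> forest_arcs F" using arc[OF u(1), of ?r] r V x arcsT' T' by blast
      then show False using arcsT r arborescenceD(4)[OF A] by blast
    qed
    have "f ` lab T = lab T'"
    proof (intro equalityI subsetI)
      fix w assume "w \<in> f ` lab T"
      then obtain v where v: "v \<in> lab T" "w = f v" by blast
      have "f v \<in> lab T'"
        using arborescenceD(6)[OF A v(1)]
      proof (induction rule: rtrancl_induct)
        case (step y z)
        then have "y \<in> verts F" "z \<in> verts F" "(y, z) \<in> forest_arcs F"
          using arcs_in_lab[OF tT] V arcsT by blast+
        then have "(f y, f z) \<in> forest_arcs F'" using arc by blast
        then show ?case using forest_arcs_in_tree(3)[OF F' T'(1)] step.IH by blast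
      qed (rule T'(2))
      then show "w \<in> lab T'" using v by simp
    next
      fix w assume "w \<in> lab T'"
      from arborescenceD(6)[OF A' this] show "w \<in> f ` lab T"
      proof (induction rule: rtrancl_induct)
        case base
        then show ?case using r root[symmetric] by simp
      next
        case (step y z)
        then obtain u where u: "u \<in> lab T" "y = f u" by blast
        have "z \<in> lab T'" using step.hyps arcs_in_lab[OF tT'] by blast
        then obtain x where x: "x \<in> verts F" "z = f x" using V' f by blast
        have "(f u, f x) \<in> forest_arcs F'" using step.hyps u x T' by (auto simp: forest_arcs_def)
        then have "(u, x) \<in> forest_arcs F" using arc[of u x] u x V by blast
        then show ?case using forest_arcs_in_tree(3)[OF F T] u x by blast
      qed
    qed
    moreover have "{u, v} \<in> edges T \<longleftrightarrow> {f u, f v} \<in> edges T'" if "u \<in> lab T" "v \<in> lab T" for u v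
    proof -
      have "f u \<in> lab T'" "f v \<in> lab T'" using that calculation by blast+
      then show ?thesis
        using arcsT arcsT' arc[of u v] arc[of v u] that V
        unfolding arb_treeD(2)[OF tT] arb_treeD(2)[OF tT'] doubleton_in_undirected by blast
    qed
    moreover have "inj_on f (lab T)" using f(1) V by (rule inj_on_subset)
    ultimately have "tree_iso f T T'" using root by (simp add: tree_iso_def bij_betw_def)
    then show ?thesis using T' by blast
  qed
  then obtain m where m: "\<And>T. T \<in> F \<Longrightarrow> m T \<in> F' \<and> tree_iso f T (m T)" by metis
  have root: "tree_root T \<in> lab T" if "T \<in> F" for T
    using root_top(1)[OF arb_forestD(1)[OF F that]] .
  have "inj_on m F"
  proof (rule inj_onI)
    fix T1 T2 assume T: "T1 \<in> F" "T2 \<in> F" "m T1 = m T2"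
    then have "f (tree_root T1) = f (tree_root T2)" using m by (metis tree_iso_def)
    moreover have "tree_root T1 \<in> verts F" "tree_root T2 \<in> verts F"
      using T root by (auto simp: verts_def)
    ultimately have "tree_root T1 = tree_root T2" using f(1) by (auto dest: inj_onD)
    then show "T1 = T2" using arb_forestD(2)[OF F] T root by metis
  qed
  moreover have "m ` F = F'"
  proof (intro equalityI subsetI)
    fix T' assume T': "T' \<in> F'"
    have rT': "tree_root T' \<in> lab T'" using root_top(1)[OF arb_forestD(1)[OF F' T']] .
    then have "tree_root T' \<in> f ` verts F" using T' f by (auto simp: verts_def)
    then obtain v where v: "v \<in> verts F" "tree_root T' = f v" by blast
    then obtain T where T: "T \<in> F" "v \<in> lab T" using tree_of_vertex by blast
    then have "f v \<in> lab (m T)" using m[OF T(1)] by (auto simp: tree_iso_def bij_betw_def)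
    then have "m T = T'" using arb_forestD(2)[OF F'] m T T' rT' v by metis
    then show "T' \<in> m ` F" using T by blast
  qed (use m in blast)
  ultimately show ?L using R m unfolding forest_iso_def bij_betw_def by blast
qed

section \<open>Morphisms and their composition\<close>

lemma LRF_Hom_iff:
  assumes F1: "arb_forest F1" and F2: "arb_forest F2"
  shows "(C1, C2, f) \<in> LRF_Hom F1 F2 \<longleftrightarrow>
    C1 \<in> admissible_cuts F1 \<and> C2 \<in> admissible_cuts F2 \<and>
    f \<in> extensional (verts F1 - verts (P C1 F1)) \<and>
    bij_betw f (verts F1 - verts (P C1 F1)) (verts (P C2 F2)) \<and>
    (\<forall>u\<in>verts F1 - verts (P C1 F1). \<forall>v\<in>verts F1 - verts (P C1 F1).
       (u, v) \<in> forest_arcs F1 \<longleftrightarrow> (f u, f v) \<in> forest_arcs F2)"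
proof (cases "C1 \<in> admissible_cuts F1 \<and> C2 \<in> admissible_cuts F2")
  case True
  note R1 = cut_parts[OF F1 conjunct1[OF True]] and P2 = cut_parts[OF F2 conjunct2[OF True]]
  have "(C1, C2, f) \<in> LRF_Hom F1 F2 \<longleftrightarrow>
      f \<in> extensional (verts (R C1 F1)) \<and> forest_iso f (R C1 F1) (P C2 F2)"
    using True by (simp add: LRF_Hom_def)
  then show ?thesis
    using True unfolding forest_iso_iff[OF R1(2) P2(1)] R1(4,6) P2(5)
    by (simp add: bij_betw_def) blast
qed (auto simp: LRF_Hom_def)

text \<open>The second cut is determined by the other data, as its cut-off part is the image of the
  bijection.\<close>

lemma LRF_Hom_eqI:
  assumes F1: "arb_forest F1" and F2: "arb_forest F2"
    and a: "(C1, C2, f) \<in> LRF_Hom F1 F2" and b: "(D1, D2, g) \<in> LRF_Hom F1 F2"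
    and S: "verts (P C1 F1) = verts (P D1 F1)" and fg: "f = g"
  shows "(C1, C2, f) = (D1, D2, g)"
proof -
  note a = a[unfolded LRF_Hom_iff[OF F1 F2]] and b = b[unfolded LRF_Hom_iff[OF F1 F2]]
  have "C1 = D1" using cut_unique[OF F1] a b S by blast
  moreover have "verts (P C2 F2) = verts (P D2 F2)"
    using a b S fg by (auto simp: bij_betw_def)
  then have "C2 = D2" using cut_unique[OF F2] a b by blast
  ultimately show ?thesis using fg by simp
qed

lemma closed_underD: "closed_under A S \<Longrightarrow> (u, v) \<in> A \<Longrightarrow> u \<in> S \<Longrightarrow> v \<in> S"
  by (auto simp: closed_under_def)

text \<open>Both vertex sets that specify the composite are closed under descendants. For the first, follow an
  arc from the source to the middle forest by \<open>f\<close>. For the second, an arc leaving \<open>g (f u)\<close> stays in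
  the cut-off part of \<open>D3\<close>, so it comes from an arc of the middle forest that starts in the cut-off
  part of \<open>C2\<close>, and therefore its end is a value of \<open>f\<close>.\<close>

lemma LRF_Comp_characterization:
  assumes F1: "arb_forest F1" and F2: "arb_forest F2" and F3: "arb_forest F3"
    and a: "(C1, C2, f) \<in> LRF_Hom F1 F2" and b: "(D2, D3, g) \<in> LRF_Hom F2 F3"
  defines "S \<equiv> verts (P C1 F1) \<union> {v \<in> verts F1 - verts (P C1 F1). f v \<in> verts (P D2 F2)}"
  shows "\<exists>!E. cuts_off F1 (E1_verts F1 F2 (D2, D3, g) (C1, C2, f)) E" (is "\<exists>!E. ?E1 E")
    and "\<exists>!E. cuts_off F3 (E3_verts F1 F2 (D2, D3, g) (C1, C2, f)) E" (is "\<exists>!E. ?E3 E")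
    and "\<exists>E1 E3. LRF_Comp F1 F2 F3 (D2, D3, g) (C1, C2, f) =
           (E1, E3, restrict (g \<circ> f) (verts F1 - S)) \<and> verts (P E1 F1) = S"
    and "LRF_Comp F1 F2 F3 (D2, D3, g) (C1, C2, f) \<in> LRF_Hom F1 F3"
proof -
  let ?V1 = "verts F1" and ?S1 = "verts (P C1 F1)" and ?S2 = "verts (P C2 F2)"
  let ?V2 = "verts F2" and ?Q2 = "verts (P D2 F2)" and ?Q3 = "verts (P D3 F3)"
  let ?a = "(C1, C2, f)" and ?b = "(D2, D3, g)"
  note a = a[unfolded LRF_Hom_iff[OF F1 F2]] and b = b[unfolded LRF_Hom_iff[OF F2 F3]]
  have C1: "C1 \<in> admissible_cuts F1" and C2: "C2 \<in> admissible_cuts F2"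
    and D2: "D2 \<in> admissible_cuts F2" and D3: "D3 \<in> admissible_cuts F3" using a b by blast+
  have f: "inj_on f (?V1 - ?S1)" "f ` (?V1 - ?S1) = ?S2" using a by (auto simp: bij_betw_def)
  have g: "inj_on g (?V2 - ?Q2)" "g ` (?V2 - ?Q2) = ?Q3" using b by (auto simp: bij_betw_def)
  have fA: "(u, v) \<in> forest_arcs F1 \<longleftrightarrow> (f u, f v) \<in> forest_arcs F2" if "u \<in> ?V1 - ?S1" "v \<in> ?V1 - ?S1" for u v
    using a that by blast
  have gA: "(u, v) \<in> forest_arcs F2 \<longleftrightarrow> (g u, g v) \<in> forest_arcs F3" if "u \<in> ?V2 - ?Q2" "v \<in> ?V2 - ?Q2" for u v
    using b that by blast
  have S2V: "?S2 \<subseteq> ?V2" using cut_parts(3)[OF F2 C2] .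
  have SV: "S \<subseteq> ?V1" using cut_parts(3)[OF F1 C1] by (auto simp: S_def)
  define X where "X = ?V1 - S"
  have X: "X = {v \<in> ?V1 - ?S1. f v \<notin> ?Q2}" by (auto simp: X_def S_def)
  have fX: "f v \<in> ?S2 - ?Q2" "f v \<in> ?V2 - ?Q2" "v \<in> ?V1 - ?S1" if "v \<in> X" for v
    using that f(2) S2V by (auto simp: X)
  have "closed_under (forest_arcs F1) S"
    unfolding closed_under_def
  proof (intro ballI, clarify)
    fix u v assume uv: "(u, v) \<in> forest_arcs F1" and u: "u \<in> S"
    have V: "u \<in> ?V1" "v \<in> ?V1" using forest_arcs_subset[OF F1] uv by auto
    show "v \<in> S"
    proof (cases "v \<in> ?S1")
      case False
      then have nu: "u \<notin> ?S1" using closed_underD[OF cut_closed[OF F1 C1] uv] by blast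
      then have "f u \<in> ?Q2" using u by (auto simp: S_def)
      moreover have "(f u, f v) \<in> forest_arcs F2" using fA uv V False nu by blast
      ultimately have "f v \<in> ?Q2" using closed_underD[OF cut_closed[OF F2 D2]] by blast
      then show ?thesis using V False by (auto simp: S_def)
    qed (simp add: S_def)
  qed
  then have ex1: "\<exists>!E. cuts_off F1 S E" using ex1_cuts_off[OF F1 SV] by blast
  have E1v: "E1_verts F1 F2 ?b ?a = S"
    using f(2) cut_parts(4)[OF F1 C1] by (auto simp: E1_verts_def S_def)
  show "\<exists>!E. ?E1 E" unfolding E1v by (rule ex1)
  define E1 where "E1 = E1_cut F1 F2 ?b ?a"
  have "cuts_off F1 S E1" unfolding E1_def E1_cut_def E1v by (rule theI'[OF ex1])
  then have E1: "E1 \<in> admissible_cuts F1" "verts (P E1 F1) = S" by (auto simp: cuts_off_def)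
  have RE1: "verts (R E1 F1) = X" using cut_parts(4)[OF F1 E1(1)] E1 by (simp add: X_def)
  let ?W = "(g \<circ> f) ` X"
  have W: "?W \<subseteq> ?Q3" using fX(2) g(2) by auto
  have "closed_under (forest_arcs F3) ?W"
    unfolding closed_under_def
  proof (intro ballI, clarify)
    fix u w assume uw: "((g \<circ> f) u, w) \<in> forest_arcs F3" and u: "u \<in> X"
    have "g (f u) \<in> ?Q3" using W u by auto
    then have "w \<in> ?Q3" using closed_underD[OF cut_closed[OF F3 D3] uw] by simp
    then obtain y where y: "y \<in> ?V2 - ?Q2" "w = g y" using g(2) by blast
    then have "(f u, y) \<in> forest_arcs F2" using gA[OF fX(2)[OF u] y(1)] uw by simp
    then have "y \<in> ?S2" using closed_underD[OF cut_closed[OF F2 C2]] fX(1)[OF u] by blast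
    then obtain v where v: "v \<in> ?V1 - ?S1" "y = f v" using f(2) by blast
    then have "v \<in> X" using y by (auto simp: X)
    then show "w \<in> ?W" using y v by auto
  qed
  moreover have "?W \<subseteq> verts F3" using W cut_parts(3)[OF F3 D3] by blast
  ultimately have ex3: "\<exists>!E. cuts_off F3 ?W E" using ex1_cuts_off[OF F3] by blast
  have E3v: "E3_verts F1 F2 ?b ?a = ?W" by (simp add: E3_verts_def E1_def[symmetric] RE1)
  show "\<exists>!E. ?E3 E" unfolding E3v by (rule ex3)
  define E3 where "E3 = E3_cut F1 F2 F3 ?b ?a"
  have "cuts_off F3 ?W E3" unfolding E3_def E3_cut_def E3v by (rule theI'[OF ex3])
  then have E3: "E3 \<in> admissible_cuts F3" "verts (P E3 F3) = ?W" by (auto simp: cuts_off_def)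
  have comp: "LRF_Comp F1 F2 F3 ?b ?a = (E1, E3, restrict (g \<circ> f) X)"
    by (simp add: LRF_Comp_def Let_def E1_def[symmetric] E3_def[symmetric] RE1)
  then show "\<exists>E1 E3. LRF_Comp F1 F2 F3 ?b ?a = (E1, E3, restrict (g \<circ> f) (verts F1 - S)) \<and>
      verts (P E1 F1) = S" using E1(2) X_def by blast
  have "inj_on (g \<circ> f) X"
  proof (rule comp_inj_on)
    show "inj_on f X" using f(1) by (rule inj_on_subset) (auto simp: X)
    show "inj_on g (f ` X)" using g(1) by (rule inj_on_subset) (use fX(2) in blast)
  qed
  then have "bij_betw (restrict (g \<circ> f) X) X ?W" by (simp add: bij_betw_def inj_on_restrict_eq)
  moreover have "(u, v) \<in> forest_arcs F1 \<longleftrightarrow> (g (f u), g (f v)) \<in> forest_arcs F3" if "u \<in> X" "v \<in> X" for u v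
    using fA[OF fX(3)[OF that(1)] fX(3)[OF that(2)]] gA[OF fX(2)[OF that(1)] fX(2)[OF that(2)]]
    by simp
  ultimately show "LRF_Comp F1 F2 F3 ?b ?a \<in> LRF_Hom F1 F3"
    unfolding comp LRF_Hom_iff[OF F1 F3] E1(2) E3(2) X_def[symmetric] using E1(1) E3(1) by simp
qed

lemma null_and_full_cuts:
  assumes F: "arb_forest F"
  shows "null_cut F \<in> admissible_cuts F" "verts (P (null_cut F) F) = {}"
    "full_cut F \<in> admissible_cuts F" "verts (P (full_cut F) F) = verts F"
proof -
  show "null_cut F \<in> admissible_cuts F" "full_cut F \<in> admissible_cuts F"
    by (auto simp: null_cut_def full_cut_def admissible_cuts_def)
  show "verts (P (full_cut F) F) = verts F" by (simp add: P_def full_cut_def)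
  have "verts (P_tree (Edge_Cut {}) T) = {}" if "T \<in> F" for T
  proof -
    note T = arb_forestD(1)[OF F that]
    have "uncut T {} = arcs T" by (auto simp: uncut_def)
    then have "lab T \<subseteq> kept T {}" using arborescenceD(6)[OF arb_treeD(1)[OF T]] by auto
    then show ?thesis unfolding tree_cut_verts(1)[OF T] by blast
  qed
  then show "verts (P (null_cut F) F) = {}"
    unfolding P_def verts_Union by (simp add: null_cut_def)
qed

lemma LRF_Id_in_Hom:
  assumes F: "arb_forest F" shows "LRF_Id F \<in> LRF_Hom F F"
  unfolding LRF_Id_def LRF_Hom_iff[OF F F] null_and_full_cuts[OF F]
  using null_and_full_cuts(1,3)[OF F] by (auto simp: bij_betw_def inj_on_def)

text \<open>By \<open>LRF_Hom_eqI\<close> it suffices to compare the cut-off parts in the first forest and the bijections.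
  Under both bracketings a vertex is cut off if it is cut off by \<open>a\<close>, or its image under \<open>f\<close> by
  \<open>b\<close>, or its image under \<open>g \<circ> f\<close> by \<open>c\<close>.\<close>

lemma LRF_Comp_assoc:
  assumes FA: "arb_forest FA" and FB: "arb_forest FB" and FC: "arb_forest FC" and FD: "arb_forest FD"
    and a: "a \<in> LRF_Hom FA FB" and b: "b \<in> LRF_Hom FB FC" and c: "c \<in> LRF_Hom FC FD"
  shows "LRF_Comp FA FC FD c (LRF_Comp FA FB FC b a) = LRF_Comp FA FB FD (LRF_Comp FB FC FD c b) a"
proof -
  obtain C1 C2 f where a_eq: "a = (C1, C2, f)" by (cases a) auto
  obtain D2 D3 g where b_eq: "b = (D2, D3, g)" by (cases b) auto
  obtain W3 W4 h where c_eq: "c = (W3, W4, h)" by (cases c) auto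
  note a = a[unfolded a_eq] and b = b[unfolded b_eq] and c = c[unfolded c_eq]
  let ?V = "verts FA" and ?S1 = "verts (P C1 FA)" and ?Q2 = "verts (P D2 FB)" and ?U3 = "verts (P W3 FC)"
  note ba = LRF_Comp_characterization(3,4)[OF FA FB FC a b]
  note cb = LRF_Comp_characterization(3,4)[OF FB FC FD b c]
  define S where "S = ?S1 \<union> {v \<in> ?V - ?S1. f v \<in> ?Q2}"
  define Q where "Q = ?Q2 \<union> {v \<in> verts FB - ?Q2. g v \<in> ?U3}"
  obtain E1 E3 where E: "LRF_Comp FA FB FC (D2, D3, g) (C1, C2, f) =
      (E1, E3, restrict (g \<circ> f) (?V - S))" "verts (P E1 FA) = S"
    using ba(1) unfolding S_def by blast
  obtain G2 G4 where G: "LRF_Comp FB FC FD (W3, W4, h) (D2, D3, g) =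
      (G2, G4, restrict (h \<circ> g) (verts FB - Q))" "verts (P G2 FB) = Q"
    using cb(1) unfolding Q_def by blast
  note E_Hom = ba(2)[unfolded E] and G_Hom = cb(2)[unfolded G]
  note l = LRF_Comp_characterization(3,4)[OF FA FC FD E_Hom c, unfolded E(2)]
  note r = LRF_Comp_characterization(3,4)[OF FA FB FD a G_Hom, unfolded G(2)]
  define L where "L = S \<union> {v \<in> ?V - S. restrict (g \<circ> f) (?V - S) v \<in> ?U3}"
  define M where "M = ?S1 \<union> {v \<in> ?V - ?S1. f v \<in> Q}"
  obtain L1 L4 where L1: "LRF_Comp FA FC FD (W3, W4, h) (E1, E3, restrict (g \<circ> f) (?V - S)) =
      (L1, L4, restrict (h \<circ> restrict (g \<circ> f) (?V - S)) (?V - L))" "verts (P L1 FA) = L"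
    using l(1) unfolding L_def by blast
  obtain M1 M4 where M1: "LRF_Comp FA FB FD (G2, G4, restrict (h \<circ> g) (verts FB - Q)) (C1, C2, f) =
      (M1, M4, restrict (restrict (h \<circ> g) (verts FB - Q) \<circ> f) (?V - M))" "verts (P M1 FA) = M"
    using r(1) unfolding M_def by blast
  have fV: "f v \<in> verts FB" if "v \<in> ?V - ?S1" for v
    using a[unfolded LRF_Hom_iff[OF FA FB]] cut_parts(3)[OF FB, of C2] that
    by (auto simp: bij_betw_def)
  have LM: "L = M" using fV by (auto simp: L_def M_def S_def Q_def)
  have "h (restrict (g \<circ> f) (?V - S) v) = restrict (h \<circ> g) (verts FB - Q) (f v)" if "v \<in> ?V - M" for v
    using that fV[of v] by (auto simp: M_def S_def Q_def)
  then have fun_eq: "restrict (h \<circ> restrict (g \<circ> f) (?V - S)) (?V - L) =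
      restrict (restrict (h \<circ> g) (verts FB - Q) \<circ> f) (?V - M)"
    unfolding LM by (intro restrict_ext) (simp only: o_apply)
  show ?thesis
    unfolding a_eq b_eq c_eq E(1) G(1) L1(1) M1(1)
    by (rule LRF_Hom_eqI[OF FA FD l(2)[unfolded L1(1)] r(2)[unfolded M1(1)] _ fun_eq])
       (simp only: L1(2) M1(2) LM)
qed

lemma LRF_Comp_Id_right:
  assumes FA: "arb_forest FA" and FB: "arb_forest FB" and a: "a \<in> LRF_Hom FA FB"
  shows "LRF_Comp FA FA FB a (LRF_Id FA) = a"
proof -
  obtain C1 C2 f where a_eq: "a = (C1, C2, f)" by (cases a) auto
  note a = a[unfolded a_eq]
  let ?V = "verts FA" and ?S1 = "verts (P C1 FA)"
  note Id = LRF_Id_in_Hom[OF FA, unfolded LRF_Id_def]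
  have S: "{} \<union> {v \<in> ?V - {}. restrict (\<lambda>v. v) ?V v \<in> ?S1} = ?S1"
    using a[unfolded LRF_Hom_iff[OF FA FB]] cut_parts(3)[OF FA, of C1] by auto
  note comp = LRF_Comp_characterization(3,4)[OF FA FA FB Id a, unfolded null_and_full_cuts(2)[OF FA] S]
  obtain E1 E3 where E: "LRF_Comp FA FA FB (C1, C2, f) (null_cut FA, full_cut FA, \<lambda>v\<in>?V. v) =
     (E1, E3, restrict (f \<circ> (\<lambda>v\<in>?V. v)) (?V - ?S1))" "verts (P E1 FA) = ?S1"
    using comp(1) by blast
  have "restrict (f \<circ> (\<lambda>v\<in>?V. v)) (?V - ?S1) = restrict f (?V - ?S1)"
    by (intro restrict_ext) simp
  also have "\<dots> = f" using a[unfolded LRF_Hom_iff[OF FA FB]] by (simp add: extensional_restrict)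
  finally show ?thesis
    unfolding a_eq LRF_Id_def E(1)
    by (intro LRF_Hom_eqI[OF FA FB comp(2)[unfolded E(1)] a E(2)])
qed

lemma LRF_Comp_Id_left:
  assumes FA: "arb_forest FA" and FB: "arb_forest FB" and a: "a \<in> LRF_Hom FA FB"
  shows "LRF_Comp FA FB FB (LRF_Id FB) a = a"
proof -
  obtain C1 C2 f where a_eq: "a = (C1, C2, f)" by (cases a) auto
  note a = a[unfolded a_eq]
  let ?V = "verts FA" and ?S1 = "verts (P C1 FA)"
  note Id = LRF_Id_in_Hom[OF FB, unfolded LRF_Id_def]
  have S: "?S1 \<union> {v \<in> ?V - ?S1. f v \<in> {}} = ?S1" by auto
  note comp = LRF_Comp_characterization(3,4)[OF FA FB FB a Id, unfolded null_and_full_cuts(2)[OF FB] S]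
  obtain E1 E3 where E: "LRF_Comp FA FB FB (null_cut FB, full_cut FB, \<lambda>v\<in>verts FB. v) (C1, C2, f) =
     (E1, E3, restrict ((\<lambda>v\<in>verts FB. v) \<circ> f) (?V - ?S1))" "verts (P E1 FA) = ?S1"
    using comp(1) by blast
  have "f v \<in> verts FB" if "v \<in> ?V - ?S1" for v
    using a[unfolded LRF_Hom_iff[OF FA FB]] cut_parts(3)[OF FB, of C2] that
    by (auto simp: bij_betw_def)
  then have "restrict ((\<lambda>v\<in>verts FB. v) \<circ> f) (?V - ?S1) = restrict f (?V - ?S1)"
    by (intro restrict_ext) simp
  also have "\<dots> = f" using a[unfolded LRF_Hom_iff[OF FA FB]] by (simp add: extensional_restrict)
  finally show ?thesis
    unfolding a_eq LRF_Id_def E(1)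
    by (intro LRF_Hom_eqI[OF FA FB comp(2)[unfolded E(1)] a E(2)])
qed

theorem theorem4p1:
  shows "LRF_Comp_well_defined \<and>
    category {F. labeled_rooted_forest F} LRF_Hom LRF_Id LRF_Comp"
proof
  note cf = labeled_rooted_forest_arb_forest
  show "LRF_Comp_well_defined"
    unfolding LRF_Comp_well_defined_def
  proof (intro allI impI, elim conjE)
    fix F1 F2 F3 a b
    assume F: "labeled_rooted_forest F1" "labeled_rooted_forest F2" "labeled_rooted_forest F3"
      and a: "a \<in> LRF_Hom F1 F2" and b: "b \<in> LRF_Hom F2 F3"
    obtain C1 C2 f D2 D3 g where eq: "a = (C1, C2, f)" "b = (D2, D3, g)"
      by (metis prod_cases3)
    show "(\<exists>!E. cuts_off F1 (E1_verts F1 F2 b a) E) \<and> (\<exists>!E. cuts_off F3 (E3_verts F1 F2 b a) E)"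
      using LRF_Comp_characterization(1,2)[OF F[THEN cf] a[unfolded eq] b[unfolded eq]]
      unfolding eq by blast
  qed
  show "category {F. labeled_rooted_forest F} LRF_Hom LRF_Id LRF_Comp"
  proof (unfold_locales, unfold mem_Collect_eq)
    fix FA FB FC a b
    assume F: "labeled_rooted_forest FA" "labeled_rooted_forest FB" "labeled_rooted_forest FC"
      and a: "a \<in> LRF_Hom FA FB" and b: "b \<in> LRF_Hom FB FC"
    obtain C1 C2 f D2 D3 g where eq: "a = (C1, C2, f)" "b = (D2, D3, g)"
      by (metis prod_cases3)
    show "LRF_Comp FA FB FC b a \<in> LRF_Hom FA FC"
      using LRF_Comp_characterization(4)[OF F[THEN cf] a[unfolded eq] b[unfolded eq]]
      unfolding eq .
  qed (blast intro: LRF_Id_in_Hom LRF_Comp_Id_left LRF_Comp_Id_right LRF_Comp_assoc cf)+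
qed

end
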